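(* For any $\zeta>0$ there is $m\in\mathbb{N}$ such that for any $\epsilon>0$ there are $\eta>0$ and $J\in\mathbb{N}$ such that the following holds for all $p\in[\zeta,1-\zeta]$ and $\lambda\in[\zeta,1]$. If $f\colon\{0,1\}^n\to[0,1]$ and $g\colon\{0,1\}^n\to\{0,1\}$ satisfy $\|\mathrm{T}^{p}_{p/2}f-\lambda g\|_1\le\eta$, then there is a set $T\subseteq[n]$ of size at most $J$ and a partition $T=A_1\cup\dots\cup A_r$ with $r\le m$ such that either $f,g$ are $\epsilon$-close to the zero function, or: (i) $g$ is $\epsilon$-close to $x\mapsto\bigwedge_{i\in[r]}\bigvee_{j\in A_i}x_j$; (ii) the function $\tilde f\colon\{0,1\}^T\to[0,1]$ given by $\tilde f(x)=\mathbb{E}_{\mathbf{y}\sim\mu_{p/2}^{[n]\setminus T}}[f(\mathbf{y},x)]$ is $\epsilon$-close to $2^r\lambda\cdot\bigwedge_{i\in[r]}\bigoplus_{j\in A_i}x_j$.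
   Context: $\mu_q$ denotes the $q$-biased product measure on $\{0,1\}^n$. For $f$ on $(\{0,1\}^n,\mu_{p/2})$, $\mathrm{T}^{p}_{p/2}f(x)=\mathbb{E}_{\mathbf{z}\sim\mu_{1/2}}[f(x\wedge\mathbf{z})]$ (coordinatewise AND), viewed as a function on $(\{0,1\}^n,\mu_p)$. $\|\cdot\|_1$ is the $L_1$ norm with respect to $\mu_p$. Two functions are $\epsilon$-close if their $L_1$ distance with respect to the measure on their input space is at most $\epsilon$ ($\mu_p$ for $g$, $\mu_{p/2}$ for $f$ and $\tilde f$). $(\mathbf{y},x)$ is the point with coordinates $\mathbf{y}$ outside $T$ and $x$ inside $T$. *)

theory Defs
  imports "HOL-Probability.Probability" "HOL-Library.Disjoint_Sets"
begin

text \<open>A point of \<open>{0,1}\<^sup>I\<close> is a function on all of \<open>nat\<close> that is \<open>False\<close> outside \<open>I\<close>;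
  this makes points extensional, and coordinatewise conjunction stays within the cube.\<close>

definition cube :: "nat set \<Rightarrow> (nat \<Rightarrow> bool) set" where
  "cube I = PiE_dflt I False (\<lambda>_. UNIV)"

definition biased :: "nat set \<Rightarrow> real \<Rightarrow> (nat \<Rightarrow> bool) pmf" where
  "biased I q = Pi_pmf I False (\<lambda>_. bernoulli_pmf q)"

definition L1_norm :: "nat set \<Rightarrow> real \<Rightarrow> ((nat \<Rightarrow> bool) \<Rightarrow> real) \<Rightarrow> real" where
  "L1_norm I q h = measure_pmf.expectation (biased I q) (\<lambda>x. \<bar>h x\<bar>)"

definition L1_close ::
  "nat set \<Rightarrow> real \<Rightarrow> real \<Rightarrow> ((nat \<Rightarrow> bool) \<Rightarrow> real) \<Rightarrow> ((nat \<Rightarrow> bool) \<Rightarrow> real) \<Rightarrow> bool" where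
  "L1_close I q \<epsilon> h k \<longleftrightarrow> L1_norm I q (\<lambda>x. h x - k x) \<le> \<epsilon>"

text \<open>The operator \<open>T\<close> from functions on \<open>{0,1}\<^sup>I\<close> with the \<open>p/2\<close>-biased measure to functions
  on \<open>{0,1}\<^sup>I\<close> with the \<open>p\<close>-biased measure. Its formula does not involve \<open>p\<close>.\<close>

definition T_half :: "nat set \<Rightarrow> ((nat \<Rightarrow> bool) \<Rightarrow> real) \<Rightarrow> (nat \<Rightarrow> bool) \<Rightarrow> real" where
  "T_half I f x = measure_pmf.expectation (biased I (1/2)) (\<lambda>z. f (\<lambda>i. x i \<and> z i))"

definition restrict_avg ::
  "nat set \<Rightarrow> real \<Rightarrow> nat set \<Rightarrow> ((nat \<Rightarrow> bool) \<Rightarrow> real) \<Rightarrow> (nat \<Rightarrow> bool) \<Rightarrow> real" where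
  "restrict_avg I q T f x =
     measure_pmf.expectation (biased (I - T) q) (\<lambda>y. f (\<lambda>i. if i \<in> T then x i else y i))"

definition and_or :: "nat set set \<Rightarrow> (nat \<Rightarrow> bool) \<Rightarrow> real" where
  "and_or P x = of_bool (\<forall>A\<in>P. \<exists>j\<in>A. x j)"

text \<open>For finite \<open>A\<close>, the exclusive or of the bits \<open>x j\<close>, \<open>j \<in> A\<close>, is the parity of the number of
  ones among them.\<close>

definition and_xor :: "nat set set \<Rightarrow> (nat \<Rightarrow> bool) \<Rightarrow> real" where
  "and_xor P x = of_bool (\<forall>A\<in>P. odd (card {j \<in> A. x j}))"

end

theory Submission
  imports Defs
begin

text \<open>
  Write \<open>h = T f\<close> with \<open>T = T_half\<close>. If \<open>u = \<psi> \<circ> h\<close> for a Lipschitz cutoff \<open>\<psi>\<close> that is locally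
  constant near \<open>0\<close> and \<open>lam\<close>, then \<open>u\<close> equals \<open>g\<close> wherever \<open>h\<close> is close to \<open>lam * g\<close>, and there
  a coordinate changes \<open>u\<close> only if it changes \<open>h\<close> by a constant amount. Bessel's inequality on the subcube
  below a point bounds the squared changes of \<open>h\<close>, and \<open>T\<close> is hypercontractive, so all but
  boundedly many coordinates have tiny total influence on \<open>u\<close>. By the Poincare inequality \<open>g\<close> hardly
  depends on the coordinates outside a bounded set \<open>T\<^sub>0\<close>.

  Fixing the coordinates outside \<open>T\<^sub>0\<close> to a typical value turns the hypothesis into an equation on a
  bounded cube that holds pointwise up to a negligible error. Its solutions are classified
  by parity: a nonnegative \<open>f\<close> is a measure under which the sets that are never avoided are hit an
  odd number of times. Hence \<open>g\<close> is close to an AND of ORs, and small parts do not depend on the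
  values fixed outside \<open>T\<^sub>0\<close>; large parts average out and are discarded.
\<close>

subsection \<open>Expectations over the biased cube\<close>

text \<open>Two scales are kept apart. The size of \<open>T\<^sub>0\<close> depends on the influence
  threshold and never on the hypothesis error, so the error may afterwards be taken exponentially
  small in that size; this pays for passing from averages to single points of the bounded cube and
  for the Moebius inversion there. Beyond being two-valued, \<open>g\<close> has no structure to
  start from: smoothness comes from \<open>T f\<close>, and the gap between its two approximate
  values \<open>0\<close> and \<open>lam\<close> turns small changes into no change at all. The
  number of parts is controlled by \<open>\<zeta>\<close> alone: at a point with exactly one element
  of each part, \<open>f\<close> averages to about \<open>2 ^ r * lam\<close>, which cannot exceed
  one. Different fixings outside \<open>T\<^sub>0\<close> may produce different large parts, but a
  part of size at most \<open>L\<close> shows on a set of measure at least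
  \<open>\<zeta> ^ (L + m)\<close>, so fixings with close restrictions of \<open>g\<close> agree on
  it. Hence the final set is the union of the small parts, of size at most
  \<open>m * L\<close>.\<close>

definition bexp :: "nat set \<Rightarrow> real \<Rightarrow> ((nat \<Rightarrow> bool) \<Rightarrow> real) \<Rightarrow> real" where
  "bexp I q h = measure_pmf.expectation (biased I q) h"

lemma cube_iff: "x \<in> cube I \<longleftrightarrow> (\<forall>i. x i \<longrightarrow> i \<in> I)"
  by (auto simp: cube_def PiE_dflt_def)

lemma finite_cube [simp, intro]: "finite I \<Longrightarrow> finite (cube I)"
  unfolding cube_def by (rule finite_PiE_dflt) auto

lemma set_biased_subset: "finite I \<Longrightarrow> set_pmf (biased I q) \<subseteq> cube I"
  using set_Pi_pmf_subset[of I False "\<lambda>_. bernoulli_pmf q"]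
  by (fastforce simp: biased_def cube_iff)

lemma finite_set_biased: "finite I \<Longrightarrow> finite (set_pmf (biased I q))"
  by (meson finite_cube finite_subset set_biased_subset)

lemma bexp_eq_sum:
  assumes "finite I"
  shows "bexp I q h = (\<Sum>x\<in>cube I. h x * pmf (biased I q) x)"
  unfolding bexp_def
  by (rule integral_measure_pmf_real) (use assms set_biased_subset in auto)

lemma bexp_cong:
  assumes "finite I" "\<And>x. x \<in> cube I \<Longrightarrow> h x = k x"
  shows "bexp I q h = bexp I q k"
  using assms by (simp add: bexp_eq_sum)

lemma bexp_mono:
  assumes "finite I" "\<And>x. x \<in> cube I \<Longrightarrow> h x \<le> k x"
  shows "bexp I q h \<le> bexp I q k"
  unfolding bexp_eq_sum[OF assms(1)] by (intro sum_mono mult_right_mono assms(2)) auto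

lemma bexp_const [simp]: "bexp I q (\<lambda>_. c) = c"
  by (simp add: bexp_def)

lemma bexp_nonneg:
  assumes "finite I" "\<And>x. x \<in> cube I \<Longrightarrow> 0 \<le> h x"
  shows "0 \<le> bexp I q h"
  using bexp_mono[of I "\<lambda>_. 0" h q] assms by simp

lemma bexp_le:
  assumes "finite I" "\<And>x. x \<in> cube I \<Longrightarrow> h x \<le> c"
  shows "bexp I q h \<le> c"
  using bexp_mono[of I h "\<lambda>_. c" q] assms by simp

lemma bexp_add: "finite I \<Longrightarrow> bexp I q (\<lambda>x. h x + k x) = bexp I q h + bexp I q k"
  by (simp add: bexp_eq_sum sum.distrib algebra_simps)

lemma bexp_diff: "finite I \<Longrightarrow> bexp I q (\<lambda>x. h x - k x) = bexp I q h - bexp I q k"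
  by (simp add: bexp_eq_sum sum_subtractf algebra_simps)

lemma bexp_cmult: "bexp I q (\<lambda>x. c * h x) = c * bexp I q h"
  by (simp add: bexp_def)

lemma bexp_multc: "bexp I q (\<lambda>x. h x * c) = bexp I q h * c"
  by (simp add: bexp_def)

lemma bexp_divide: "bexp I q (\<lambda>x. h x / c) = bexp I q h / c"
  by (simp add: bexp_def)

lemma bexp_sum: "finite I \<Longrightarrow> bexp I q (\<lambda>x. \<Sum>j\<in>J. h j x) = (\<Sum>j\<in>J. bexp I q (h j))"
  by (simp add: bexp_eq_sum sum_distrib_right sum.swap[of _ J])

lemma bexp_abs: "finite I \<Longrightarrow> \<bar>bexp I q h\<bar> \<le> bexp I q (\<lambda>x. \<bar>h x\<bar>)"
  unfolding bexp_eq_sum by (rule order.trans[OF sum_abs]) (simp add: abs_mult)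

lemma bexp_swap:
  assumes "finite I" "finite J"
  shows "bexp I q (\<lambda>x. bexp J r (\<lambda>y. h x y)) = bexp J r (\<lambda>y. bexp I q (\<lambda>x. h x y))"
  unfolding bexp_eq_sum[OF assms(1)] bexp_eq_sum[OF assms(2)] sum_distrib_right
  by (subst sum.swap) (simp add: mult_ac)

lemma bexp_empty [simp]: "bexp {} q h = h (\<lambda>_. False)"
  by (simp add: bexp_def biased_def)

lemma bexp_insert:
  assumes "finite I" "i \<notin> I" "0 \<le> q" "q \<le> 1"
  shows "bexp (insert i I) q h =
    q * bexp I q (\<lambda>x. h (x(i := True))) + (1 - q) * bexp I q (\<lambda>x. h (x(i := False)))"
proof -
  have eq: "biased (insert i I) q =
      bernoulli_pmf q \<bind> (\<lambda>y. map_pmf (\<lambda>x. x(i := y)) (biased I q))"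
    unfolding biased_def Pi_pmf_insert'[OF assms(1,2)] by (simp add: map_pmf_def)
  have fin: "finite (set_pmf (map_pmf (\<lambda>x. x(i := y)) (biased I q)))" for y
    using finite_set_biased[OF assms(1)] by simp
  show ?thesis
    unfolding bexp_def eq
    by (subst pmf_expectation_bind[where A = UNIV])
       (use assms fin in \<open>auto simp: UNIV_bool\<close>)
qed

lemma bexp_union:
  assumes "finite I" "finite J" "I \<inter> J = {}"
  shows "bexp (I \<union> J) q h =
    bexp I q (\<lambda>x. bexp J q (\<lambda>y. h (\<lambda>i. if i \<in> I then x i else y i)))"
proof -
  let ?h = "\<lambda>(x, y). h (\<lambda>i. if i \<in> I then x i else y i)"
  have "bexp (I \<union> J) q h = measure_pmf.expectation (pair_pmf (biased I q) (biased J q)) ?h"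
    unfolding bexp_def biased_def Pi_pmf_union[OF assms] by (simp add: case_prod_unfold)
  also have "\<dots> = (\<Sum>z\<in>cube I \<times> cube J. ?h z * pmf (pair_pmf (biased I q) (biased J q)) z)"
    by (rule integral_measure_pmf_real)
      (use assms set_biased_subset[of I q] set_biased_subset[of J q] in auto)
  also have "\<dots> = bexp I q (\<lambda>x. bexp J q (\<lambda>y. ?h (x, y)))"
    unfolding bexp_eq_sum[OF assms(1)] bexp_eq_sum[OF assms(2)] sum_distrib_right
    by (subst sum.cartesian_product) (auto intro!: sum.cong simp: pmf_pair)
  finally show ?thesis by simp
qed

lemma bexp_split:
  assumes "finite I" "T \<subseteq> I"
  shows "bexp I q h = bexp T q (\<lambda>x. bexp (I - T) q (\<lambda>y. h (\<lambda>i. if i \<in> T then x i else y i)))"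
  using bexp_union[of T "I - T" q h] assms finite_subset[of T I]
  by (simp add: Un_absorb1)

lemma bexp_subset:
  assumes "finite I" "J \<subseteq> I"
  shows "bexp J q h = bexp I q (\<lambda>x. h (\<lambda>i. i \<in> J \<and> x i))"
proof -
  have "biased J q = map_pmf (\<lambda>x i. i \<in> J \<and> x i) (biased I q)"
    unfolding biased_def Pi_pmf_subset[OF assms]
    by (rule map_pmf_cong) auto
  thus ?thesis by (simp add: bexp_def)
qed

text \<open>The conjunction of independent bits of bias \<open>p\<close> and \<open>k\<close> has
  bias \<open>p * k\<close>. This links the two measures of the theorem and lets noise operators be
  composed.\<close>

lemma bexp_compose:
  assumes "finite I" "0 \<le> p" "p \<le> 1" "0 \<le> k" "k \<le> 1"
  shows "bexp I p (\<lambda>x. bexp I k (\<lambda>z. h (\<lambda>i. x i \<and> z i))) = bexp I (p * k) h"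
  using assms(1)
proof (induction I arbitrary: h rule: finite_induct)
  case (insert j I)
  have upd: "(\<lambda>i. (x(j := a)) i \<and> (z(j := b)) i) = (\<lambda>i. x i \<and> z i)(j := a \<and> b)"
    for x z :: "nat \<Rightarrow> bool" and a b by auto
  have 1: "bexp I p (\<lambda>x. bexp I k (\<lambda>z. h ((\<lambda>i. x i \<and> z i)(j := a)))) =
    bexp I (p * k) (\<lambda>x. h (x(j := a)))" for a
    using insert.IH[of "\<lambda>x. h (x(j := a))"] by simp
  have pk: "0 \<le> p * k" "p * k \<le> 1" using assms by (auto simp: mult_le_one)
  show ?case
    using insert.hyps assms pk
    by (simp only: bexp_insert upd bexp_add bexp_cmult 1 simp_thms) (simp add: algebra_simps)
qed simp

lemma bexp_not_dep:
  assumes "finite I" "J \<subseteq> I" "\<And>x. x \<in> cube I \<Longrightarrow> h (\<lambda>i. i \<in> J \<and> x i) = h x"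
  shows "bexp I q h = bexp J q h"
  using bexp_subset[OF assms(1,2), of q h] bexp_cong[OF assms(1), of "\<lambda>x. h (\<lambda>i. i \<in> J \<and> x i)" h q] assms(3)
  by simp

lemma bexp_markov:
  assumes "finite I" "t > 0" "\<And>x. x \<in> cube I \<Longrightarrow> 0 \<le> h x"
  shows "bexp I q (\<lambda>x. of_bool (h x > t)) \<le> bexp I q h / t"
  unfolding bexp_divide[symmetric]
  by (rule bexp_mono[OF assms(1)]) (use assms in \<open>auto simp: field_simps\<close>)

text \<open>Each point has mass at least \<open>\<zeta> ^ card I\<close>, so on a cube of bounded
  dimension a small average of a nonnegative function is small everywhere.\<close>

lemma bexp_point:
  assumes "finite I" "a \<in> cube I" "0 < \<zeta>" "\<zeta> \<le> q" "q \<le> 1 - \<zeta>"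
    "\<And>x. x \<in> cube I \<Longrightarrow> 0 \<le> h x"
  shows "\<zeta> ^ card I * h a \<le> bexp I q h"
  using assms(1,2,6)
proof (induction I arbitrary: a h rule: finite_induct)
  case empty
  thus ?case by (auto simp: cube_iff)
next
  case (insert j I)
  define b where "b = a(j := False)"
  have b: "b \<in> cube I" using insert.prems(1) by (auto simp: b_def cube_iff)
  have nn: "0 \<le> h (x(j := c))" if "x \<in> cube I" for x c
    by (rule insert.prems(2)) (use that in \<open>auto simp: cube_iff\<close>)
  have *: "\<zeta> ^ card I * h (b(j := c)) \<le> bexp I q (\<lambda>x. h (x(j := c)))" for c
    using insert.IH[OF b, of "\<lambda>x. h (x(j := c))"] nn by simp
  have n: "0 \<le> bexp I q (\<lambda>x. h (x(j := c)))" for c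
    by (rule bexp_nonneg[OF insert.hyps(1)]) (rule nn)
  have ab: "b(j := a j) = a" by (auto simp: b_def)
  have "\<zeta> ^ card (insert j I) * h a = \<zeta> * (\<zeta> ^ card I * h (b(j := a j)))"
    using insert.hyps ab by simp
  also have "\<dots> \<le> \<zeta> * bexp I q (\<lambda>x. h (x(j := a j)))"
    using *[of "a j"] assms(3) by (intro mult_left_mono) auto
  also have "\<dots> \<le> (if a j then q else 1 - q) * bexp I q (\<lambda>x. h (x(j := a j)))"
    by (rule mult_right_mono) (use assms n in auto)
  also have "\<dots> \<le> bexp (insert j I) q h"
    using insert.hyps assms(3-5) n[of True] n[of False] by (cases "a j") (simp_all add: bexp_insert)
  finally show ?case .
qed

subsection \<open>Bessel, Poincare and hypercontractive inequalities\<close>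

definition cdiff :: "nat \<Rightarrow> ((nat \<Rightarrow> bool) \<Rightarrow> real) \<Rightarrow> (nat \<Rightarrow> bool) \<Rightarrow> real" where
  "cdiff i u x = u (x(i := True)) - u (x(i := False))"

text \<open>The one-sided noise operator: each one of \<open>x\<close> survives with probability
  \<open>k\<close>, and zeros stay zero. \<open>T_half\<close> is the case \<open>k = 1/2\<close>;
  general \<open>k\<close> makes it possible to factor it.\<close>

definition thin :: "real \<Rightarrow> nat set \<Rightarrow> ((nat \<Rightarrow> bool) \<Rightarrow> real) \<Rightarrow> (nat \<Rightarrow> bool) \<Rightarrow> real" where
  "thin k I u x = bexp I k (\<lambda>z. u (\<lambda>i. x i \<and> z i))"

lemma cdiff_upd_same [simp]: "cdiff i u (x(i := c)) = cdiff i u x"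
  by (simp add: cdiff_def)

lemma cdiff_upd: "i \<noteq> j \<Longrightarrow> cdiff i u (x(j := c)) = cdiff i (\<lambda>x. u (x(j := c))) x"
  by (simp add: cdiff_def fun_upd_twist)

text \<open>The variance of a two-valued variable, the induction step of both the Bessel and the
  Poincare inequality.\<close>

lemma convex_sq:
  fixes q a b :: real
  shows "q * a\<^sup>2 + (1 - q) * b\<^sup>2 = (q * a + (1 - q) * b)\<^sup>2 + q * (1 - q) * (a - b)\<^sup>2"
  by (simp add: power2_eq_square algebra_simps)

text \<open>The summands are the squared degree-one coefficients of \<open>f\<close> in the
  orthonormal basis of the biased cube. Splitting off a coordinate makes the mean a two-valued
  variable whose variance is the new summand, while the old coefficients only shrink under
  averaging.\<close>

lemma bexp_bessel:
  assumes "finite I" "0 \<le> q" "q \<le> 1"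
  shows "(bexp I q f)\<^sup>2 + (\<Sum>i\<in>I. q * (1 - q) * (bexp I q (cdiff i f))\<^sup>2) \<le> bexp I q (\<lambda>x. (f x)\<^sup>2)"
  using assms(1)
proof (induction I arbitrary: f rule: finite_induct)
  case (insert j I)
  define F where "F = (\<lambda>c x. f (x(j := c)))"
  define a where "a = (\<lambda>c. bexp I q (F c))"
  define d where "d = (\<lambda>c i. bexp I q (cdiff i (F c)))"
  note ins = bexp_insert[OF insert.hyps assms(2,3)]
  have E: "bexp (insert j I) q f = q * a True + (1 - q) * a False"
    by (simp add: ins a_def F_def)
  have Di: "bexp (insert j I) q (cdiff i f) = q * d True i + (1 - q) * d False i" if "i \<in> I" for i
  proof -
    have "i \<noteq> j" using that insert.hyps by auto
    thus ?thesis by (simp add: ins cdiff_upd d_def F_def)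
  qed
  have Dj: "bexp (insert j I) q (cdiff j f) = a True - a False"
    using insert.hyps by (simp add: ins a_def F_def cdiff_def bexp_diff algebra_simps)
  have "(\<Sum>i\<in>I. q * (1 - q) * (bexp (insert j I) q (cdiff i f))\<^sup>2)
      \<le> (\<Sum>i\<in>I. q * (q * (1 - q) * (d True i)\<^sup>2) + (1 - q) * (q * (1 - q) * (d False i)\<^sup>2))"
  proof (rule sum_mono)
    fix i assume "i \<in> I"
    have "(q * d True i + (1 - q) * d False i)\<^sup>2 \<le> q * (d True i)\<^sup>2 + (1 - q) * (d False i)\<^sup>2"
      unfolding convex_sq using assms by simp
    hence "q * (1 - q) * (q * d True i + (1 - q) * d False i)\<^sup>2
      \<le> q * (1 - q) * (q * (d True i)\<^sup>2 + (1 - q) * (d False i)\<^sup>2)"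
      using assms by (intro mult_left_mono) auto
    thus "q * (1 - q) * (bexp (insert j I) q (cdiff i f))\<^sup>2
      \<le> q * (q * (1 - q) * (d True i)\<^sup>2) + (1 - q) * (q * (1 - q) * (d False i)\<^sup>2)"
      unfolding Di[OF \<open>i \<in> I\<close>] by (simp add: algebra_simps)
  qed
  also have "\<dots> = q * (\<Sum>i\<in>I. q * (1 - q) * (d True i)\<^sup>2) +
      (1 - q) * (\<Sum>i\<in>I. q * (1 - q) * (d False i)\<^sup>2)"
    by (simp add: sum.distrib sum_distrib_left)
  finally have S: "(\<Sum>i\<in>I. q * (1 - q) * (bexp (insert j I) q (cdiff i f))\<^sup>2) \<le> \<dots>" .
  have IH: "(a c)\<^sup>2 + (\<Sum>i\<in>I. q * (1 - q) * (d c i)\<^sup>2) \<le> bexp I q (\<lambda>x. (F c x)\<^sup>2)" for c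
    using insert.IH[of "F c"] by (simp add: a_def d_def)
  have "(bexp (insert j I) q f)\<^sup>2
      + (\<Sum>i\<in>insert j I. q * (1 - q) * (bexp (insert j I) q (cdiff i f))\<^sup>2)
    \<le> q * ((a True)\<^sup>2 + (\<Sum>i\<in>I. q * (1 - q) * (d True i)\<^sup>2))
      + (1 - q) * ((a False)\<^sup>2 + (\<Sum>i\<in>I. q * (1 - q) * (d False i)\<^sup>2))"
    using S convex_sq[of q "a True" "a False"] insert.hyps
    by (simp add: E Dj distrib_left)
  also have "\<dots> \<le> q * bexp I q (\<lambda>x. (F True x)\<^sup>2) + (1 - q) * bexp I q (\<lambda>x. (F False x)\<^sup>2)"
    using assms by (intro add_mono mult_left_mono IH) auto
  also have "\<dots> = bexp (insert j I) q (\<lambda>x. (f x)\<^sup>2)"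
    by (simp add: ins F_def)
  finally show ?case .
qed simp

text \<open>Variance splits into the average variance inside the two halves and the variance of
  their means; by Jensen the latter is at most the energy of the new coordinate.\<close>

lemma bexp_poincare:
  assumes "finite I" "0 \<le> q" "q \<le> 1"
  shows "bexp I q (\<lambda>x. (u x)\<^sup>2) - (bexp I q u)\<^sup>2
    \<le> (\<Sum>i\<in>I. q * (1 - q) * bexp I q (\<lambda>x. (cdiff i u x)\<^sup>2))"
  using assms(1)
proof (induction I arbitrary: u rule: finite_induct)
  case (insert j I)
  define F where "F = (\<lambda>c x. u (x(j := c)))"
  define a where "a = (\<lambda>c. bexp I q (F c))"
  define d where "d = (\<lambda>c i. bexp I q (\<lambda>x. (cdiff i (F c) x)\<^sup>2))"
  note ins = bexp_insert[OF insert.hyps assms(2,3)]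
  have E: "bexp (insert j I) q u = q * a True + (1 - q) * a False"
    by (simp add: ins a_def F_def)
  have Di: "bexp (insert j I) q (\<lambda>x. (cdiff i u x)\<^sup>2) = q * d True i + (1 - q) * d False i"
    if "i \<in> I" for i
  proof -
    have "i \<noteq> j" using that insert.hyps by auto
    thus ?thesis by (simp add: ins cdiff_upd d_def F_def)
  qed
  have Dj: "bexp (insert j I) q (\<lambda>x. (cdiff j u x)\<^sup>2) = bexp I q (\<lambda>x. (F True x - F False x)\<^sup>2)"
    by (simp add: ins cdiff_def F_def algebra_simps)
  have "(a True - a False)\<^sup>2 = (bexp I q (\<lambda>x. F True x - F False x))\<^sup>2"
    using insert.hyps by (simp add: a_def bexp_diff)
  also have "\<dots> \<le> bexp I q (\<lambda>x. (F True x - F False x)\<^sup>2)"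
    using bexp_bessel[OF insert.hyps(1) assms(2,3), of "\<lambda>x. F True x - F False x"] assms
    by (smt (verit) mult_nonneg_nonneg sum_nonneg zero_le_power2)
  finally have J: "q * (1 - q) * (a True - a False)\<^sup>2
      \<le> q * (1 - q) * bexp (insert j I) q (\<lambda>x. (cdiff j u x)\<^sup>2)"
    unfolding Dj using assms by (intro mult_left_mono) auto
  have IH: "bexp I q (\<lambda>x. (F c x)\<^sup>2) \<le> (a c)\<^sup>2 + (\<Sum>i\<in>I. q * (1 - q) * d c i)" for c
    using insert.IH[of "F c"] by (simp add: a_def d_def)
  have "bexp (insert j I) q (\<lambda>x. (u x)\<^sup>2)
    = q * bexp I q (\<lambda>x. (F True x)\<^sup>2) + (1 - q) * bexp I q (\<lambda>x. (F False x)\<^sup>2)"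
    by (simp add: ins F_def)
  also have "\<dots> \<le> q * ((a True)\<^sup>2 + (\<Sum>i\<in>I. q * (1 - q) * d True i))
      + (1 - q) * ((a False)\<^sup>2 + (\<Sum>i\<in>I. q * (1 - q) * d False i))"
    using assms by (intro add_mono mult_left_mono IH) auto
  also have "\<dots> = (bexp (insert j I) q u)\<^sup>2 + q * (1 - q) * (a True - a False)\<^sup>2
      + (\<Sum>i\<in>I. q * (1 - q) * bexp (insert j I) q (\<lambda>x. (cdiff i u x)\<^sup>2))"
  proof -
    have "(\<Sum>i\<in>I. q * (1 - q) * bexp (insert j I) q (\<lambda>x. (cdiff i u x)\<^sup>2))
      = (\<Sum>i\<in>I. q * (q * (1 - q) * d True i) + (1 - q) * (q * (1 - q) * d False i))"
      by (intro sum.cong refl) (simp add: Di algebra_simps)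
    also have "\<dots> = q * (\<Sum>i\<in>I. q * (1 - q) * d True i) + (1 - q) * (\<Sum>i\<in>I. q * (1 - q) * d False i)"
      by (simp add: sum.distrib sum_distrib_left)
    finally have S: "(\<Sum>i\<in>I. q * (1 - q) * bexp (insert j I) q (\<lambda>x. (cdiff i u x)\<^sup>2)) = \<dots>" .
    show ?thesis
      unfolding S E distrib_left using convex_sq[of q "a True" "a False"] by linarith
  qed
  also have "\<dots> \<le> (bexp (insert j I) q u)\<^sup>2
      + (\<Sum>i\<in>insert j I. q * (1 - q) * bexp (insert j I) q (\<lambda>x. (cdiff i u x)\<^sup>2))"
    using J insert.hyps by simp
  finally show ?case by simp
qed simp

section \<open>Hypercontractivity of one-sided noise\<close>

lemma powr_le_tangent:
  fixes w a :: real
  assumes "0 \<le> w" "0 \<le> a" "a \<le> 1"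
  shows "w powr (1 + a) \<le> w + a * (w * (w - 1))"
proof (cases "w = 0")
  case False
  hence "w > 0" using assms by simp
  \<comment> \<open>Weighted AM-GM of \<open>w\<close> and \<open>1\<close>. Multiplied by
    \<open>w\<close> it is tangent to the power at \<open>w = 1\<close>, with an error that averages
    to \<open>a\<close> times a variance when \<open>w\<close> has mean one.\<close>
  have "w powr a * 1 powr (1 - a) \<le> a * w + (1 - a) * 1"
    by (rule Youngs_inequality_0) (use assms \<open>w > 0\<close> in auto)
  hence "w * w powr a \<le> w * (a * w + (1 - a))"
    using \<open>w > 0\<close> by (intro mult_left_mono) auto
  thus ?thesis using \<open>w > 0\<close> by (simp add: powr_add algebra_simps)
qed simp

text \<open>With squares normalised to mean one, the tangent bound above reduces the claim to comparing
  the variance of the squares with the squared difference lost by averaging.\<close>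

lemma two_point_hypercontractive:
  fixes a b p k \<theta> :: real
  assumes "0 < p" "p < 1" "0 < k" "k < 1" "0 \<le> a" "0 \<le> b"
    "0 \<le> \<theta>" "\<theta> \<le> 2" "\<theta> \<le> p * (1 - k) / k"
  shows "p * ((1 - k) * a + k * b) powr (2 + \<theta>) + (1 - p) * a powr (2 + \<theta>)
    \<le> (p * k * b\<^sup>2 + (1 - p * k) * a\<^sup>2) powr (1 + \<theta> / 2)"
proof -
  define v where "v = (1 - k) * a + k * b"
  define c where "c = p * (1 - k) / k"
  define Q where "Q = p * v\<^sup>2 + (1 - p) * a\<^sup>2"
  define \<alpha> where "\<alpha> = \<theta> / 2"
  have v: "0 \<le> v" using assms by (simp add: v_def)
  have c: "0 \<le> c" using assms by (simp add: c_def)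
  have al: "0 \<le> \<alpha>" "\<alpha> \<le> 1" "2 * \<alpha> \<le> c" using assms by (auto simp: \<alpha>_def c_def)
  \<comment> \<open>\<open>v\<close> is the conditional mean given a one before the noise, so the
    second moment exceeds \<open>Q\<close> by \<open>p\<close> times the conditional variance
    \<open>k * (1 - k) * (b - a)\<^sup>2\<close>.\<close>
  have R: "p * k * b\<^sup>2 + (1 - p * k) * a\<^sup>2 = Q + c * (v - a)\<^sup>2"
  proof -
    have "c * (v - a)\<^sup>2 = p * (1 - k) * k * (b - a)\<^sup>2"
    proof -
      have "v - a = k * (b - a)" by (simp add: v_def algebra_simps)
      thus ?thesis unfolding c_def using assms by (simp only:) (simp add: power2_eq_square)
    qed
    thus ?thesis by (simp add: Q_def v_def power2_eq_square algebra_simps)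
  qed
  have pw: "x powr (2 + \<theta>) = (x\<^sup>2) powr (1 + \<alpha>)" if "0 \<le> x" for x :: real
  proof -
    have "(x\<^sup>2) powr (1 + \<alpha>) = (x powr 2) powr (1 + \<alpha>)"
      using that by simp
    also have "\<dots> = x powr (2 + \<theta>)" by (subst powr_powr) (simp add: \<alpha>_def distrib_left)
    finally show ?thesis by simp
  qed
  show ?thesis
  proof (cases "Q = 0")
    case True
    hence "p * v\<^sup>2 = 0" "(1 - p) * a\<^sup>2 = 0"
      using assms unfolding Q_def by (smt (verit) mult_nonneg_nonneg zero_le_power2)+
    thus ?thesis using assms by (simp add: v_def)
  next
    case False
    have "0 \<le> Q" using assms by (simp add: Q_def)
    with False have Q: "0 < Q" by simp
    define w1 where "w1 = v\<^sup>2 / Q"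
    define w0 where "w0 = a\<^sup>2 / Q"
    define t where "t = (v - a)\<^sup>2 / Q"
    have w: "0 \<le> w1" "0 \<le> w0" "0 \<le> t" using Q by (auto simp: w1_def w0_def t_def)
    have mean: "p * w1 + (1 - p) * w0 = 1"
      using Q by (simp add: w1_def w0_def Q_def add_divide_distrib[symmetric])
    \<comment> \<open>Since \<open>w1 - w0\<close> is \<open>(v - a) * (v + a) / Q\<close>,
      absorbing the factor with \<open>v + a\<close> into \<open>Q\<close> bounds the variance by
      \<open>2 * t\<close>.\<close>
    have "(v + a)\<^sup>2 \<le> 2 * (v\<^sup>2 + a\<^sup>2)"
      using sum_squares_bound[of v a] by (simp add: power2_eq_square algebra_simps)
    hence "p * (1 - p) * (v + a)\<^sup>2 \<le> p * (1 - p) * (2 * (v\<^sup>2 + a\<^sup>2))"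
      using assms by (intro mult_left_mono) auto
    also have "\<dots> = 2 * ((1 - p) * (p * v\<^sup>2) + p * ((1 - p) * a\<^sup>2))"
      by (simp add: algebra_simps)
    also have "\<dots> \<le> 2 * (1 * (p * v\<^sup>2) + 1 * ((1 - p) * a\<^sup>2))"
      using assms by (intro mult_left_mono add_mono mult_right_mono) auto
    finally have A: "p * (1 - p) * (v + a)\<^sup>2 \<le> 2 * Q" by (simp add: Q_def)
    have "p * (1 - p) * (w1 - w0)\<^sup>2 = (p * (1 - p) * (v + a)\<^sup>2) * (v - a)\<^sup>2 / Q\<^sup>2"
      by (simp add: w1_def w0_def diff_divide_distrib[symmetric] power_divide)
         (simp add: power2_eq_square algebra_simps)
    also have "\<dots> \<le> (2 * Q) * (v - a)\<^sup>2 / Q\<^sup>2"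
      by (intro divide_right_mono mult_right_mono A) auto
    also have "\<dots> = 2 * t" using Q by (simp add: t_def power2_eq_square)
    finally have V: "p * (1 - p) * (w1 - w0)\<^sup>2 \<le> 2 * t" .
    have var: "p * (w1 * (w1 - 1)) + (1 - p) * (w0 * (w0 - 1)) = p * (1 - p) * (w1 - w0)\<^sup>2"
    proof -
      have "p * (w1 * (w1 - 1)) + (1 - p) * (w0 * (w0 - 1))
        = (p * w1\<^sup>2 + (1 - p) * w0\<^sup>2) - (p * w1 + (1 - p) * w0)"
        by (simp add: power2_eq_square algebra_simps)
      thus ?thesis unfolding convex_sq mean by simp
    qed
    have "p * w1 powr (1 + \<alpha>) + (1 - p) * w0 powr (1 + \<alpha>)
      \<le> p * (w1 + \<alpha> * (w1 * (w1 - 1))) + (1 - p) * (w0 + \<alpha> * (w0 * (w0 - 1)))"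
      using assms w al by (intro add_mono mult_left_mono powr_le_tangent) auto
    also have "\<dots> = (p * w1 + (1 - p) * w0)
        + \<alpha> * (p * (w1 * (w1 - 1)) + (1 - p) * (w0 * (w0 - 1)))"
      by (simp add: algebra_simps)
    also have "\<dots> = 1 + \<alpha> * (p * (1 - p) * (w1 - w0)\<^sup>2)"
      unfolding var mean ..
    also have "\<dots> \<le> 1 + \<alpha> * (2 * t)" using V al by (simp add: mult_left_mono)
    \<comment> \<open>The upper bound on \<open>\<theta>\<close> enters here, in the form
      \<open>2 * \<alpha> \<le> c\<close>.\<close>
    also have "\<dots> \<le> 1 + c * t" using mult_right_mono[OF al(3) w(3)] by (simp add: mult_ac)
    also have "\<dots> = (1 + c * t) powr 1" using c w by (simp add: add_nonneg_pos)
    also have "\<dots> \<le> (1 + c * t) powr (1 + \<alpha>)"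
      using c w al by (intro powr_mono) auto
    finally have main: "p * w1 powr (1 + \<alpha>) + (1 - p) * w0 powr (1 + \<alpha>) \<le> (1 + c * t) powr (1 + \<alpha>)" .
    have e1: "v\<^sup>2 = Q * w1" "a\<^sup>2 = Q * w0" "Q + c * (v - a)\<^sup>2 = Q * (1 + c * t)"
      using Q by (simp_all add: w1_def w0_def t_def field_simps)
    have "p * v powr (2 + \<theta>) + (1 - p) * a powr (2 + \<theta>)
      = Q powr (1 + \<alpha>) * (p * w1 powr (1 + \<alpha>) + (1 - p) * w0 powr (1 + \<alpha>))"
      unfolding pw[OF v] pw[OF assms(5)] e1 using Q w
      by (simp add: powr_mult algebra_simps)
    also have "\<dots> \<le> Q powr (1 + \<alpha>) * (1 + c * t) powr (1 + \<alpha>)"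
      by (intro mult_left_mono main) auto
    also have "\<dots> = (Q + c * (v - a)\<^sup>2) powr (1 + \<alpha>)"
      unfolding e1(3) using Q c w by (simp add: powr_mult)
    finally show ?thesis unfolding R by (simp add: v_def \<alpha>_def)
  qed
qed

text \<open>Minkowski's inequality for the biased measure, obtained from \<open>L2_set\<close> by
  weighting with the square roots of the point masses.\<close>

lemma bexp_L2_triangle:
  assumes "finite I" "0 \<le> s" "0 \<le> t"
  shows "sqrt (bexp I q (\<lambda>x. (s * u x + t * v x)\<^sup>2))
    \<le> s * sqrt (bexp I q (\<lambda>x. (u x)\<^sup>2)) + t * sqrt (bexp I q (\<lambda>x. (v x)\<^sup>2))"
proof -
  define r where "r = (\<lambda>x. sqrt (pmf (biased I q) x))"
  have r: "(r x)\<^sup>2 = pmf (biased I q) x" for x by (simp add: r_def)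
  have L: "sqrt (bexp I q (\<lambda>x. (w x)\<^sup>2)) = L2_set (\<lambda>x. w x * r x) (cube I)" for w
    by (simp add: bexp_eq_sum assms L2_set_def power_mult_distrib r)
  have "L2_set (\<lambda>x. (s * u x + t * v x) * r x) (cube I)
     = L2_set (\<lambda>x. s * (u x * r x) + t * (v x * r x)) (cube I)"
    by (simp add: algebra_simps)
  also have "\<dots> \<le> L2_set (\<lambda>x. s * (u x * r x)) (cube I) + L2_set (\<lambda>x. t * (v x * r x)) (cube I)"
    by (rule L2_set_triangle_ineq)
  finally show ?thesis
    unfolding L using assms by (simp add: L2_set_right_distrib)
qed

lemma thin_insert:
  assumes "finite I" "j \<notin> I" "0 \<le> k" "k \<le> 1"
  shows "thin k (insert j I) u (x(j := c)) =
    (if c then (1 - k) * thin k I (\<lambda>y. u (y(j := False))) x + k * thin k I (\<lambda>y. u (y(j := True))) x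
     else thin k I (\<lambda>y. u (y(j := False))) x)"
proof -
  have upd: "(\<lambda>i. (x(j := a)) i \<and> (z(j := b)) i) = (\<lambda>i. x i \<and> z i)(j := a \<and> b)"
    for x z :: "nat \<Rightarrow> bool" and a b by auto
  show ?thesis
    unfolding thin_def bexp_insert[OF assms] upd by (simp add: algebra_simps)
qed

lemma thin_comb:
  assumes "finite I"
  shows "thin k I (\<lambda>x. s * u x + t * v x) x = s * thin k I u x + t * thin k I v x"
  by (simp add: thin_def bexp_add bexp_cmult assms)

text \<open>Induction over coordinates. Given that coordinate \<open>j\<close> is one, noise
  replaces \<open>u\<close> by the mixture \<open>V\<close> of its two halves; Minkowski bounds the
  norm of \<open>V\<close> by the same mixture of \<open>sqrt (N False)\<close> and
  \<open>sqrt (N True)\<close>, and the two-point inequality applies to these numbers.\<close>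

lemma thin_hypercontractive:
  assumes "finite I" "0 < p" "p < 1" "0 < k" "k < 1"
    "0 \<le> \<theta>" "\<theta> \<le> 2" "\<theta> \<le> p * (1 - k) / k" "\<And>x. 0 \<le> u x"
  shows "bexp I p (\<lambda>x. thin k I u x powr (2 + \<theta>))
    \<le> bexp I (p * k) (\<lambda>x. (u x)\<^sup>2) powr (1 + \<theta> / 2)"
  using assms(1,9)
proof (induction I arbitrary: u rule: finite_induct)
  case empty
  have "u (\<lambda>_. False) powr (2 + \<theta>) = (u (\<lambda>_. False) powr 2) powr (1 + \<theta> / 2)"
    by (subst powr_powr) (simp add: distrib_left)
  thus ?case using empty by (simp add: thin_def)
next
  case (insert j I)
  define U where "U = (\<lambda>c y. u (y(j := c)))"
  define N where "N = (\<lambda>c. bexp I (p * k) (\<lambda>x. (U c x)\<^sup>2))"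
  define V where "V = (\<lambda>x. (1 - k) * U False x + k * U True x)"
  have pk: "0 \<le> p * k" "p * k \<le> 1" using assms by (auto simp: mult_le_one)
  have U: "0 \<le> U c x" for c x using insert.prems by (simp add: U_def)
  have V: "0 \<le> V x" for x using U assms by (simp add: V_def)
  have N: "0 \<le> N c" for c by (simp add: N_def bexp_nonneg insert.hyps)
  have pw: "x powr (1 + \<theta> / 2) = sqrt x powr (2 + \<theta>)" if "0 \<le> x" for x :: real
  proof -
    have "x powr (1 + \<theta> / 2) = (x powr (1/2)) powr (2 + \<theta>)"
      by (subst powr_powr) (simp add: add_divide_distrib)
    thus ?thesis using that by (simp add: powr_half_sqrt)
  qed
  have T1: "thin k (insert j I) u (x(j := True)) = thin k I V x" for x
    unfolding V_def thin_comb[OF insert.hyps(1)]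
    using insert.hyps assms by (simp add: thin_insert U_def)
  have T0: "thin k (insert j I) u (x(j := False)) = thin k I (U False) x" for x
    using insert.hyps assms by (simp add: thin_insert U_def)
  have b1: "bexp I p (\<lambda>x. thin k I V x powr (2 + \<theta>))
    \<le> ((1 - k) * sqrt (N False) + k * sqrt (N True)) powr (2 + \<theta>)"
  proof -
    have "bexp I p (\<lambda>x. thin k I V x powr (2 + \<theta>)) \<le> bexp I (p * k) (\<lambda>x. (V x)\<^sup>2) powr (1 + \<theta> / 2)"
      by (rule insert.IH) (rule V)
    also have "\<dots> = sqrt (bexp I (p * k) (\<lambda>x. (V x)\<^sup>2)) powr (2 + \<theta>)"
      by (rule pw) (simp add: bexp_nonneg insert.hyps)
    also have "\<dots> \<le> ((1 - k) * sqrt (N False) + k * sqrt (N True)) powr (2 + \<theta>)"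
      unfolding V_def N_def using assms
      by (intro powr_mono2 bexp_L2_triangle insert.hyps) (auto simp: bexp_nonneg insert.hyps)
    finally show ?thesis .
  qed
  have b0: "bexp I p (\<lambda>x. thin k I (U False) x powr (2 + \<theta>)) \<le> sqrt (N False) powr (2 + \<theta>)"
    using insert.IH[of "U False", OF U] pw[OF N[of False]] unfolding N_def by linarith
  have "bexp (insert j I) p (\<lambda>x. thin k (insert j I) u x powr (2 + \<theta>))
    = p * bexp I p (\<lambda>x. thin k I V x powr (2 + \<theta>))
      + (1 - p) * bexp I p (\<lambda>x. thin k I (U False) x powr (2 + \<theta>))"
    using insert.hyps assms by (simp add: bexp_insert T0 T1)
  also have "\<dots> \<le> p * ((1 - k) * sqrt (N False) + k * sqrt (N True)) powr (2 + \<theta>)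
      + (1 - p) * sqrt (N False) powr (2 + \<theta>)"
    using assms by (intro add_mono mult_left_mono b0 b1) auto
  also have "\<dots> \<le> (p * k * (sqrt (N True))\<^sup>2 + (1 - p * k) * (sqrt (N False))\<^sup>2) powr (1 + \<theta> / 2)"
    by (rule two_point_hypercontractive) (use assms N in auto)
  also have "\<dots> = bexp (insert j I) (p * k) (\<lambda>x. (u x)\<^sup>2) powr (1 + \<theta> / 2)"
    using N insert.hyps pk by (simp add: bexp_insert N_def U_def)
  finally show ?case .
qed

text \<open>Coordinate \<open>i\<close> matters only if the noise keeps it, which has probability
  \<open>k\<close>; the difference itself does not see coordinate \<open>i\<close>.\<close>

lemma cdiff_thin:
  assumes "finite I" "i \<in> I" "0 \<le> k" "k \<le> 1"
  shows "cdiff i (thin k I u) x = k * thin k I (cdiff i u) x"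
proof -
  define J where "J = I - {i}"
  have J: "finite J" "i \<notin> J" "I = insert i J" using assms by (auto simp: J_def)
  have 1: "thin k I (cdiff i u) x = thin k J (cdiff i u) x"
  proof (cases "x i")
    case True
    hence x: "x(i := True) = x" by (simp add: fun_upd_idem)
    have "thin k I (cdiff i u) x = thin k (insert i J) (cdiff i u) (x(i := True))"
      by (simp only: x J(3)[symmetric])
    also have "\<dots> = thin k J (cdiff i u) x"
      unfolding thin_insert[OF J(1,2) assms(3,4)] by (simp add: algebra_simps)
    finally show ?thesis .
  next
    case False
    hence x: "x(i := False) = x" by (simp add: fun_upd_idem)
    have "thin k I (cdiff i u) x = thin k (insert i J) (cdiff i u) (x(i := False))"
      by (simp only: x J(3)[symmetric])
    also have "\<dots> = thin k J (cdiff i u) x"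
      unfolding thin_insert[OF J(1,2) assms(3,4)] by simp
    finally show ?thesis .
  qed
  have 2: "thin k J (cdiff i u) x = thin k J (\<lambda>y. u (y(i := True))) x - thin k J (\<lambda>y. u (y(i := False))) x"
    by (simp add: thin_def cdiff_def bexp_diff J(1))
  show ?thesis
    unfolding 1 2 unfolding J(3) cdiff_def[of i "thin k (insert i J) u"]
    by (simp add: thin_insert[OF J(1,2) assms(3,4)] algebra_simps)
qed

lemma thin_restrict:
  assumes "finite I" "x \<in> cube I"
  shows "thin k I u x = bexp {i. x i} k u"
proof -
  have "{i. x i} \<subseteq> I" using assms by (auto simp: cube_iff)
  thus ?thesis using bexp_subset[OF assms(1), of "{i. x i}" k u] by (simp add: thin_def)
qed

text \<open>At \<open>x\<close> the noise averages \<open>f\<close> over the subcube below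
  \<open>x\<close>, so differences in directions with \<open>x i\<close> are \<open>k\<close> times
  means of differences of \<open>f\<close> there. Bessel on that subcube gives a bound free of the
  dimension.\<close>

lemma sum_cdiff_thin_sq_le:
  assumes "finite I" "x \<in> cube I" "0 < k" "k < 1" "\<And>x. \<bar>f x\<bar> \<le> 1"
  shows "(\<Sum>i | x i. (cdiff i (thin k I f) x)\<^sup>2) \<le> k / (1 - k)"
proof -
  let ?X = "{i. x i}"
  have X: "?X \<subseteq> I" using assms by (auto simp: cube_iff)
  hence fX: "finite ?X" using assms(1) finite_subset by blast
  have d: "cdiff i (thin k I f) x = k * bexp ?X k (cdiff i f)" if "i \<in> ?X" for i
    using cdiff_thin[OF assms(1), of i k f x] thin_restrict[OF assms(1,2), of k "cdiff i f"] X that assms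
    by auto
  have "(bexp ?X k f)\<^sup>2 + (\<Sum>i\<in>?X. k * (1 - k) * (bexp ?X k (cdiff i f))\<^sup>2) \<le> bexp ?X k (\<lambda>x. (f x)\<^sup>2)"
    by (rule bexp_bessel) (use fX assms in auto)
  also have "\<dots> \<le> 1" by (rule bexp_le[OF fX]) (use assms(5) in \<open>simp add: abs_square_le_1\<close>)
  finally have "(\<Sum>i\<in>?X. k * (1 - k) * (bexp ?X k (cdiff i f))\<^sup>2) \<le> 1"
    by (smt (verit) zero_le_power2)
  hence 1: "k / (1 - k) * (\<Sum>i\<in>?X. k * (1 - k) * (bexp ?X k (cdiff i f))\<^sup>2) \<le> k / (1 - k) * 1"
    using assms by (intro mult_left_mono) auto
  have "(\<Sum>i\<in>?X. (cdiff i (thin k I f) x)\<^sup>2) = (\<Sum>i\<in>?X. k / (1 - k) * (k * (1 - k) * (bexp ?X k (cdiff i f))\<^sup>2))"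
    by (intro sum.cong refl) (use assms d in \<open>simp add: power_mult_distrib power2_eq_square\<close>)
  also have "\<dots> \<le> k / (1 - k)" using 1 by (simp add: sum_distrib_left)
  finally show ?thesis .
qed

subsection \<open>Approximation by juntas\<close>

definition glue :: "nat set \<Rightarrow> (nat \<Rightarrow> bool) \<Rightarrow> (nat \<Rightarrow> bool) \<Rightarrow> nat \<Rightarrow> bool" where
  "glue T a w = (\<lambda>i. if i \<in> T then a i else w i)"

lemma bexp_glue:
  assumes "finite I" "T \<subseteq> I"
  shows "bexp I q h = bexp T q (\<lambda>a. bexp (I - T) q (\<lambda>w. h (glue T a w)))"
  using bexp_split[OF assms] by (simp add: glue_def)

lemma glue_cube: "T \<subseteq> I \<Longrightarrow> a \<in> cube T \<Longrightarrow> w \<in> cube (I - T) \<Longrightarrow> glue T a w \<in> cube I"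
  unfolding cube_iff glue_def by (metis Diff_iff subsetD)

lemma thin_thin:
  assumes "finite I" "0 \<le> k" "k \<le> 1" "0 \<le> l" "l \<le> 1"
  shows "thin k I (thin l I f) x = thin (k * l) I f x"
  unfolding thin_def using bexp_compose[OF assms, of "\<lambda>y. f (\<lambda>i. x i \<and> y i)"]
  by (simp add: conj_assoc)

lemma bexp_coord:
  assumes "finite I" "i \<in> I" "0 \<le> q" "q \<le> 1" "\<And>x c. G (x(i := c)) = G x"
  shows "bexp I q (\<lambda>x. of_bool (x i) * G x) = q * bexp I q G"
proof -
  define J where "J = I - {i}"
  have J: "finite J" "i \<notin> J" "insert i J = I" using assms by (auto simp: J_def)
  show ?thesis
    using bexp_insert[OF J(1,2) assms(3,4), of G]
      bexp_insert[OF J(1,2) assms(3,4), of "\<lambda>x. of_bool (x i) * G x"] assms(5)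
    unfolding J(3) by (simp add: algebra_simps)
qed

text \<open>The pointwise bound covers only directions in which \<open>x\<close> is one. As the
  difference in direction \<open>i\<close> ignores \<open>x i\<close>, extending the sum to all
  directions costs a factor \<open>1 / q\<close>.\<close>

lemma sum_bexp_cdiff_thin_sq_le:
  assumes "finite I" "0 < q" "q \<le> 1" "0 < k" "k < 1" "\<And>x. \<bar>f x\<bar> \<le> 1"
  shows "(\<Sum>i\<in>I. bexp I q (\<lambda>x. (cdiff i (thin k I f) x)\<^sup>2)) \<le> k / (1 - k) / q"
proof -
  let ?d = "\<lambda>i x. (cdiff i (thin k I f) x)\<^sup>2"
  have "q * (\<Sum>i\<in>I. bexp I q (?d i)) = (\<Sum>i\<in>I. bexp I q (\<lambda>x. of_bool (x i) * ?d i x))"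
    unfolding sum_distrib_left
    by (intro sum.cong refl bexp_coord[symmetric]) (use assms in auto)
  also have "\<dots> = bexp I q (\<lambda>x. \<Sum>i\<in>I. of_bool (x i) * ?d i x)"
    by (rule bexp_sum[OF assms(1), symmetric])
  also have "\<dots> \<le> k / (1 - k)"
  proof (rule bexp_le[OF assms(1)])
    fix x assume x: "x \<in> cube I"
    have "(\<Sum>i\<in>I. of_bool (x i) * ?d i x) = (\<Sum>i | x i. ?d i x)"
      using x assms(1)
      by (intro sum.mono_neutral_cong_right) (auto simp: cube_iff)
    also have "\<dots> \<le> k / (1 - k)" by (rule sum_cdiff_thin_sq_le[OF assms(1) x assms(4-6)])
    finally show "(\<Sum>i\<in>I. of_bool (x i) * ?d i x) \<le> k / (1 - k)" .
  qed
  finally show ?thesis using assms by (simp add: field_simps)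
qed

lemma bexp_two_samples:
  assumes "finite J"
  shows "bexp J q (\<lambda>x. bexp J q (\<lambda>y. (u x - u y)\<^sup>2)) = 2 * (bexp J q (\<lambda>x. (u x)\<^sup>2) - (bexp J q u)\<^sup>2)"
  by (simp add: power2_diff bexp_add bexp_diff bexp_cmult bexp_multc assms)
     (simp add: power2_eq_square)

lemma cdiff_glue: "i \<notin> T \<Longrightarrow> cdiff i (\<lambda>w. u (glue T a w)) w = cdiff i u (glue T a w)"
proof -
  assume "i \<notin> T"
  hence "glue T a (w(i := c)) = (glue T a w)(i := c)" for c by (intro ext) (auto simp: glue_def)
  thus ?thesis by (simp add: cdiff_def)
qed

text \<open>Poincare in each fibre, averaged over the base. Two independent completions replace the
  conditional mean, so that the estimate can be carried over to the values of \<open>g\<close>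
  themselves.\<close>

lemma bexp_poincare_outside:
  assumes "finite I" "T \<subseteq> I" "0 \<le> q" "q \<le> 1"
  shows "bexp T q (\<lambda>a. bexp (I - T) q (\<lambda>w. bexp (I - T) q (\<lambda>w'. (u (glue T a w) - u (glue T a w'))\<^sup>2)))
    \<le> 2 * (\<Sum>i\<in>I - T. q * (1 - q) * bexp I q (\<lambda>x. (cdiff i u x)\<^sup>2))"
proof -
  have fT: "finite T" "finite (I - T)" using assms finite_subset by auto
  have "bexp T q (\<lambda>a. bexp (I - T) q (\<lambda>w. bexp (I - T) q (\<lambda>w'. (u (glue T a w) - u (glue T a w'))\<^sup>2)))
    \<le> bexp T q (\<lambda>a. 2 * (\<Sum>i\<in>I - T. q * (1 - q) * bexp (I - T) q (\<lambda>w. (cdiff i u (glue T a w))\<^sup>2)))"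
  proof (rule bexp_mono[OF fT(1)])
    fix a
    have "bexp (I - T) q (\<lambda>w. bexp (I - T) q (\<lambda>w'. (u (glue T a w) - u (glue T a w'))\<^sup>2))
      \<le> 2 * (\<Sum>i\<in>I - T. q * (1 - q) * bexp (I - T) q (\<lambda>w. (cdiff i (\<lambda>w. u (glue T a w)) w)\<^sup>2))"
      unfolding bexp_two_samples[OF fT(2), of q "\<lambda>w. u (glue T a w)"]
      using bexp_poincare[OF fT(2) assms(3,4), of "\<lambda>w. u (glue T a w)"] by simp
    also have "\<dots> = 2 * (\<Sum>i\<in>I - T. q * (1 - q) * bexp (I - T) q (\<lambda>w. (cdiff i u (glue T a w))\<^sup>2))"
      by (simp add: cdiff_glue)
    finally show "bexp (I - T) q (\<lambda>w. bexp (I - T) q (\<lambda>w'. (u (glue T a w) - u (glue T a w'))\<^sup>2)) \<le> \<dots>" .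
  qed
  also have "\<dots> = 2 * (\<Sum>i\<in>I - T. q * (1 - q) * bexp I q (\<lambda>x. (cdiff i u x)\<^sup>2))"
    by (simp add: bexp_cmult bexp_sum fT bexp_glue[OF assms(1,2)])
  finally show ?thesis .
qed

text \<open>The factorisation \<open>1/2 = 3/4 * 2/3\<close> splits the operator in two: the factor \<open>2/3\<close> makes the
  total influence bounded, the factor \<open>3/4\<close> supplies the hypercontractivity.\<close>

lemma junta_approximation:
  fixes f g :: "(nat \<Rightarrow> bool) \<Rightarrow> real" and p lam \<zeta> \<eta> \<tau> :: real
  assumes I: "finite I" and z: "0 < \<zeta>" "\<zeta> \<le> p" "p \<le> 1 - \<zeta>" and lam: "\<zeta> \<le> lam" "lam \<le> 1"
    and f: "\<And>x. 0 \<le> f x" "\<And>x. f x \<le> 1" and g: "\<And>x. g x \<in> {0, 1}"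
    and eta: "bexp I p (\<lambda>x. \<bar>thin (1/2) I f x - lam * g x\<bar>) \<le> \<eta>" and tau: "0 < \<tau>"
  obtains T where "T \<subseteq> I" "real (card T) \<le> 3 / (\<zeta> * \<tau>)"
    "bexp T p (\<lambda>a. bexp (I - T) p (\<lambda>w. bexp (I - T) p (\<lambda>w'. \<bar>g (glue T a w) - g (glue T a w')\<bar>)))
      \<le> 120 * \<eta> / \<zeta> ^ 3 + 1152 / \<zeta> ^ 4 * \<tau> powr (\<zeta> / 6)"
proof -
  have p: "0 < p" "p < 1" using z by auto
  have lam0: "0 < lam" using lam z by auto
  \<comment> \<open>Retention \<open>3/4\<close> allows exponents up to \<open>2 + p / 3\<close>,
    and \<open>p\<close> is at least \<open>\<zeta>\<close>.\<close>
  define \<theta> where "\<theta> = \<zeta> / 3"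
  have th: "0 \<le> \<theta>" "\<theta> \<le> 1" "\<theta> \<le> p * (1 - 3/4) / (3/4)" using z by (auto simp: \<theta>_def)
  \<comment> \<open>The bias on the domain of \<open>f1\<close>: noise of retention
    \<open>3/4\<close> carries functions from there to the \<open>p\<close>-biased cube.\<close>
  define q where "q = p * (3/4)"
  have q: "0 < q" "q \<le> 1" using p by (auto simp: q_def)
  define h where "h = thin (1/2) I f"
  define f1 where "f1 = thin (2/3) I f"
  have hf1: "h = thin (3/4) I f1"
    by (rule ext) (simp add: h_def f1_def thin_thin[OF I])
  define \<sigma> where "\<sigma> = (\<lambda>i. bexp I q (\<lambda>x. (cdiff i f1 x)\<^sup>2))"
  have sg0: "0 \<le> \<sigma> i" for i by (simp add: \<sigma>_def bexp_nonneg I)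
  have f_abs: "\<bar>f x\<bar> \<le> 1" for x using f[of x] by simp
  have sg: "(\<Sum>i\<in>I. \<sigma> i) \<le> 2 / q"
    using sum_bexp_cdiff_thin_sq_le[OF I q, of "2/3" f] f_abs by (simp add: \<sigma>_def f1_def)
  \<comment> \<open>The coordinates are selected by their influence on \<open>f1\<close>, not on
    \<open>g\<close>: the sum of these influences is bounded whatever \<open>\<eta>\<close>
    is.\<close>
  define T where "T = {i\<in>I. \<sigma> i > \<tau>}"
  have T: "T \<subseteq> I" "finite T" using I by (auto simp: T_def)
  have "\<tau> * card T \<le> (\<Sum>i\<in>T. \<sigma> i)"
    using sum_mono[of T "\<lambda>_. \<tau>" \<sigma>] by (auto simp: T_def mult.commute)
  also have "\<dots> \<le> (\<Sum>i\<in>I. \<sigma> i)" by (rule sum_mono2[OF I T(1)]) (use sg0 in auto)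
  also have "\<dots> \<le> 2 / q" by (rule sg)
  also have "\<dots> \<le> 3 / \<zeta>" using z p by (simp add: q_def field_simps)
  finally have cT: "real (card T) \<le> 3 / (\<zeta> * \<tau>)" using tau z by (simp add: field_simps)
  define bad where "bad = (\<lambda>x. \<bar>h x - lam * g x\<bar> > lam / 6)"
  define B where "B = bexp I p (\<lambda>x. of_bool (bad x))"
  have B: "B \<le> 6 * \<eta> / \<zeta>"
  proof -
    have "B \<le> bexp I p (\<lambda>x. \<bar>h x - lam * g x\<bar>) / (lam / 6)"
      unfolding B_def bad_def by (rule bexp_markov[OF I]) (use lam0 in auto)
    also have "\<dots> \<le> \<eta> / (lam / 6)"
      using eta lam0 by (intro divide_right_mono) (auto simp: h_def)
    also have "\<dots> = 6 * (\<eta> / lam)" by simp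
    also have "\<dots> \<le> 6 * (\<eta> / \<zeta>)"
    proof -
      have "0 \<le> bexp I p (\<lambda>x. \<bar>thin (1/2) I f x - lam * g x\<bar>)" by (rule bexp_nonneg[OF I]) simp
      hence "0 \<le> \<eta>" using eta by linarith
      thus ?thesis using z lam by (intro mult_left_mono divide_left_mono) auto
    qed
    finally show ?thesis by simp
  qed
  \<comment> \<open>A ramp from \<open>lam / 3\<close> to \<open>2 * lam / 3\<close>. Off the bad
    points \<open>h\<close> lies within \<open>lam / 6\<close> of \<open>0\<close> or
    \<open>lam\<close>, so a change of \<open>h\<close> below \<open>lam / 6\<close> stays in a flat
    range.\<close>
  define \<psi> where "\<psi> = (\<lambda>t::real. min 1 (max 0 ((t - lam/3) * (3/lam))))"
  have psi_lip: "\<bar>\<psi> s - \<psi> t\<bar> \<le> 3 / lam * \<bar>s - t\<bar>" for s t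
  proof -
    have "\<bar>\<psi> s - \<psi> t\<bar> \<le> \<bar>(s - lam/3) * (3/lam) - (t - lam/3) * (3/lam)\<bar>"
      unfolding \<psi>_def by linarith
    also have "\<dots> = \<bar>(s - t) * (3 / lam)\<bar>" by (simp only: left_diff_distrib[symmetric]) simp
    also have "\<dots> = 3 / lam * \<bar>s - t\<bar>" unfolding abs_mult using lam0 by simp
    finally show ?thesis .
  qed
  have psi0: "\<psi> t = 0" if "t \<le> lam / 3" for t
  proof -
    have "(t - lam/3) * (3/lam) \<le> 0" using that lam0 by (intro mult_nonpos_nonneg) auto
    thus ?thesis unfolding \<psi>_def by linarith
  qed
  have psi1: "\<psi> t = 1" if "t \<ge> 2 * lam / 3" for t
  proof -
    have "1 \<le> (t - lam/3) * (3/lam)" using that lam0 by (simp add: field_simps)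
    thus ?thesis unfolding \<psi>_def by linarith
  qed
  define u where "u = (\<lambda>x. \<psi> (h x))"
  have u_g: "u x = g x" if "\<not> bad x" for x
  proof (cases "g x = 0")
    case True
    hence "\<bar>h x\<bar> \<le> lam / 6" using that by (simp add: bad_def)
    hence "h x \<le> lam / 3" using lam0 by linarith
    thus ?thesis using psi0 True by (simp add: u_def)
  next
    case False
    hence "g x = 1" using g[of x] by auto
    hence "\<bar>h x - lam\<bar> \<le> lam / 6" using that by (simp add: bad_def)
    hence "h x \<ge> 2 * lam / 3" using lam0 by linarith
    thus ?thesis using psi1 \<open>g x = 1\<close> by (simp add: u_def)
  qed
  \<comment> \<open>A bad point gets the Lipschitz bound. Elsewhere a change of \<open>u\<close>
    forces a change of \<open>h\<close> of at least \<open>lam / 6\<close>; then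
    \<open>6 / lam\<close> times it is at least one, and any power of it dominates the trivial
    bound. The power \<open>2 + \<theta>\<close> is the one that hypercontractivity
    controls.\<close>
  have chain: "(cdiff i u x)\<^sup>2 \<le> of_bool (bad x) * (9 / lam\<^sup>2) * (cdiff i h x)\<^sup>2 + (6 / lam * \<bar>cdiff i h x\<bar>) powr (2 + \<theta>)"
    if "x i" for x i
  proof -
    have xi: "x(i := True) = x" using that by (simp add: fun_upd_idem)
    define y where "y = x(i := False)"
    have d: "cdiff i h x = h x - h y" "cdiff i u x = \<psi> (h x) - \<psi> (h y)"
      by (simp_all add: cdiff_def xi y_def u_def)
    consider "bad x" | "\<not> bad x" "\<bar>cdiff i h x\<bar> < lam / 6" | "\<bar>cdiff i h x\<bar> \<ge> lam / 6" by linarith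
    thus ?thesis
    proof cases
      case 1
      have "\<bar>cdiff i u x\<bar> \<le> \<bar>3 / lam * \<bar>cdiff i h x\<bar>\<bar>" using psi_lip[of "h x" "h y"] d lam0 by simp
      hence "(cdiff i u x)\<^sup>2 \<le> (3 / lam * \<bar>cdiff i h x\<bar>)\<^sup>2" by (rule abs_le_square_iff[THEN iffD1])
      thus ?thesis using 1 by (simp add: power_mult_distrib power_divide add_increasing2)
    next
      case 2
      have "\<psi> (h x) = \<psi> (h y)"
      proof (cases "g x = 0")
        case True
        hence "\<bar>h x\<bar> \<le> lam / 6" using 2 by (simp add: bad_def)
        hence "h x \<le> lam / 3" "h y \<le> lam / 3" using 2(2) lam0 d(1) by linarith+
        thus ?thesis using psi0 by simp
      next
        case False
        hence "g x = 1" using g[of x] by auto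
        hence "\<bar>h x - lam\<bar> \<le> lam / 6" using 2 by (simp add: bad_def)
        hence "h x \<ge> 2 * lam / 3" "h y \<ge> 2 * lam / 3" using 2(2) lam0 d(1) by linarith+
        thus ?thesis using psi1 by simp
      qed
      hence "cdiff i u x = 0" using d by simp
      thus ?thesis by simp
    next
      case 3
      have "\<bar>cdiff i u x\<bar> \<le> 1" unfolding d \<psi>_def by linarith
      hence "(cdiff i u x)\<^sup>2 \<le> 1" by (simp add: abs_square_le_1)
      also have "1 \<le> (6 / lam * \<bar>cdiff i h x\<bar>) powr (2 + \<theta>)"
        using 3 lam0 th by (intro ge_one_powr_ge_zero) (auto simp: field_simps)
      finally show ?thesis by (simp add: add_increasing)
    qed
  qed
  \<comment> \<open>The exponent above two yields a spare factor
    \<open>\<sigma> i powr (\<theta> / 2)\<close>, small outside \<open>T\<close>, and still leaves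
    one power of \<open>\<sigma> i\<close> to be summed.\<close>
  have hyper: "bexp I p (\<lambda>x. \<bar>cdiff i h x\<bar> powr (2 + \<theta>)) \<le> \<tau> powr (\<theta> / 2) * \<sigma> i" if "i \<in> I - T" for i
  proof -
    have "bexp I p (\<lambda>x. \<bar>cdiff i h x\<bar> powr (2 + \<theta>))
      \<le> bexp I p (\<lambda>x. thin (3/4) I (\<lambda>y. \<bar>cdiff i f1 y\<bar>) x powr (2 + \<theta>))"
    proof (rule bexp_mono[OF I], rule powr_mono2)
      fix x
      have "\<bar>cdiff i h x\<bar> = 3/4 * \<bar>thin (3/4) I (cdiff i f1) x\<bar>"
        using cdiff_thin[OF I, of i "3/4" f1 x] that by (simp add: hf1 abs_mult)
      also have "\<dots> \<le> 1 * \<bar>thin (3/4) I (cdiff i f1) x\<bar>" by (intro mult_right_mono) auto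
      also have "\<dots> \<le> thin (3/4) I (\<lambda>y. \<bar>cdiff i f1 y\<bar>) x"
        unfolding thin_def using bexp_abs[OF I] by simp
      finally show "\<bar>cdiff i h x\<bar> \<le> thin (3/4) I (\<lambda>y. \<bar>cdiff i f1 y\<bar>) x" .
    qed (use th in auto)
    also have "\<dots> \<le> bexp I (p * (3/4)) (\<lambda>x. \<bar>cdiff i f1 x\<bar>\<^sup>2) powr (1 + \<theta> / 2)"
      by (rule thin_hypercontractive[OF I p]) (use th in auto)
    also have "\<dots> = \<sigma> i powr (\<theta> / 2) * \<sigma> i"
      using sg0[of i] by (cases "\<sigma> i = 0") (auto simp: \<sigma>_def q_def powr_add)
    also have "\<dots> \<le> \<tau> powr (\<theta> / 2) * \<sigma> i"
      using that sg0[of i] th by (intro mult_right_mono powr_mono2) (auto simp: T_def)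
    finally show ?thesis .
  qed
  have c6: "(6 / lam) powr (2 + \<theta>) \<le> (6 / \<zeta>) ^ 3"
  proof -
    have "(6 / lam) powr (2 + \<theta>) \<le> (6 / lam) powr 3"
      using lam lam0 th by (intro powr_mono) (auto simp: field_simps)
    also have "\<dots> = (6 / lam) ^ 3" using lam0 powr_realpow[of "6 / lam" 3] by simp
    also have "\<dots> \<le> (6 / \<zeta>) ^ 3"
      using lam lam0 z by (intro power_mono divide_left_mono) auto
    finally show ?thesis .
  qed
  have "p * (\<Sum>i\<in>I - T. bexp I p (\<lambda>x. (cdiff i u x)\<^sup>2))
    = (\<Sum>i\<in>I - T. bexp I p (\<lambda>x. of_bool (x i) * (cdiff i u x)\<^sup>2))"
    unfolding sum_distrib_left
    by (intro sum.cong refl bexp_coord[symmetric]) (use I p in auto)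
  also have "\<dots> \<le> (\<Sum>i\<in>I - T. bexp I p (\<lambda>x. of_bool (bad x) * (9 / lam\<^sup>2) * (of_bool (x i) * (cdiff i h x)\<^sup>2)
      + (6 / lam) powr (2 + \<theta>) * \<bar>cdiff i h x\<bar> powr (2 + \<theta>)))"
  proof (intro sum_mono bexp_mono I)
    fix i x
    show "of_bool (x i) * (cdiff i u x)\<^sup>2 \<le> of_bool (bad x) * (9 / lam\<^sup>2) * (of_bool (x i) * (cdiff i h x)\<^sup>2)
      + (6 / lam) powr (2 + \<theta>) * \<bar>cdiff i h x\<bar> powr (2 + \<theta>)"
      using chain[of x i] lam0 by (cases "x i") (auto simp: powr_mult powr_divide)
  qed
  also have "\<dots> = bexp I p (\<lambda>x. \<Sum>i\<in>I - T. of_bool (bad x) * (9 / lam\<^sup>2) * (of_bool (x i) * (cdiff i h x)\<^sup>2))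
      + (\<Sum>i\<in>I - T. (6 / lam) powr (2 + \<theta>) * bexp I p (\<lambda>x. \<bar>cdiff i h x\<bar> powr (2 + \<theta>)))"
    by (simp add: bexp_add bexp_sum I sum.distrib bexp_cmult)
  also have "\<dots> \<le> bexp I p (\<lambda>x. 9 / lam\<^sup>2 * of_bool (bad x))
      + (\<Sum>i\<in>I - T. (6 / \<zeta>) ^ 3 * (\<tau> powr (\<theta> / 2) * \<sigma> i))"
  proof (intro add_mono bexp_mono sum_mono I)
    fix x assume x: "x \<in> cube I"
    \<comment> \<open>At a single point the squared changes of \<open>h\<close> sum to at most one
      over the directions, so bad points cost their probability and not a multiple of the
      dimension.\<close>
    have "(\<Sum>i\<in>I - T. of_bool (x i) * (cdiff i h x)\<^sup>2) \<le> (\<Sum>i\<in>I. of_bool (x i) * (cdiff i h x)\<^sup>2)"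
      by (rule sum_mono2[OF I]) auto
    also have "\<dots> = (\<Sum>i | x i. (cdiff i h x)\<^sup>2)"
      using x I by (intro sum.mono_neutral_cong_right) (auto simp: cube_iff)
    also have "\<dots> \<le> 1" using sum_cdiff_thin_sq_le[OF I x, of "1/2" f] f_abs by (simp add: h_def)
    finally have "of_bool (bad x) * (9 / lam\<^sup>2) * (\<Sum>i\<in>I - T. of_bool (x i) * (cdiff i h x)\<^sup>2)
      \<le> of_bool (bad x) * (9 / lam\<^sup>2) * 1"
      by (intro mult_left_mono) auto
    thus "(\<Sum>i\<in>I - T. of_bool (bad x) * (9 / lam\<^sup>2) * (of_bool (x i) * (cdiff i h x)\<^sup>2))
      \<le> 9 / lam\<^sup>2 * of_bool (bad x)"
      unfolding sum_distrib_left[symmetric] by (simp only: mult_1_right mult.commute[of "9 / lam\<^sup>2"])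
  next
    fix i assume "i \<in> I - T"
    thus "(6 / lam) powr (2 + \<theta>) * bexp I p (\<lambda>x. \<bar>cdiff i h x\<bar> powr (2 + \<theta>))
      \<le> (6 / \<zeta>) ^ 3 * (\<tau> powr (\<theta> / 2) * \<sigma> i)"
      using c6 hyper z by (intro mult_mono) (auto simp: bexp_nonneg I)
  qed
  also have "\<dots> = 9 / lam\<^sup>2 * B + (6 / \<zeta>) ^ 3 * \<tau> powr (\<theta> / 2) * (\<Sum>i\<in>I - T. \<sigma> i)"
    by (simp only: bexp_cmult B_def sum_distrib_left mult.assoc)
  also have "\<dots> \<le> 9 / \<zeta>\<^sup>2 * (6 * \<eta> / \<zeta>) + (6 / \<zeta>) ^ 3 * \<tau> powr (\<theta> / 2) * (8 / (3 * \<zeta>))"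
  proof -
    have "9 / lam\<^sup>2 \<le> 9 / \<zeta>\<^sup>2" using lam z lam0 by (intro divide_left_mono power_mono) auto
    moreover have "0 \<le> B" by (simp add: B_def bexp_nonneg I)
    ultimately have 1: "9 / lam\<^sup>2 * B \<le> 9 / \<zeta>\<^sup>2 * (6 * \<eta> / \<zeta>)" by (intro mult_mono B) auto
    have "(\<Sum>i\<in>I - T. \<sigma> i) \<le> (\<Sum>i\<in>I. \<sigma> i)" by (rule sum_mono2[OF I]) (use sg0 in auto)
    also have "\<dots> \<le> 2 / q" by (rule sg)
    also have "\<dots> \<le> 8 / (3 * \<zeta>)" using z p by (simp add: q_def field_simps)
    finally have "(6 / \<zeta>) ^ 3 * \<tau> powr (\<theta> / 2) * (\<Sum>i\<in>I - T. \<sigma> i)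
      \<le> (6 / \<zeta>) ^ 3 * \<tau> powr (\<theta> / 2) * (8 / (3 * \<zeta>))"
      using z by (intro mult_left_mono) auto
    with 1 show ?thesis by linarith
  qed
  also have "\<dots> = 54 * \<eta> / \<zeta> ^ 3 + 576 / \<zeta> ^ 4 * \<tau> powr (\<zeta> / 6)"
  proof -
    have "(6 / \<zeta>) ^ 3 * X * (8 / (3 * \<zeta>)) = 576 / \<zeta> ^ 4 * X" for X
      by (simp add: power_divide power3_eq_cube power4_eq_xxxx)
    moreover have "9 / \<zeta>\<^sup>2 * (6 * \<eta> / \<zeta>) = 54 * \<eta> / \<zeta> ^ 3"
      by (simp add: power2_eq_square power3_eq_cube)
    ultimately show ?thesis by (simp add: \<theta>_def)
  qed
  finally have inf: "p * (\<Sum>i\<in>I - T. bexp I p (\<lambda>x. (cdiff i u x)\<^sup>2))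
    \<le> 54 * \<eta> / \<zeta> ^ 3 + 576 / \<zeta> ^ 4 * \<tau> powr (\<zeta> / 6)" .
  let ?W = "I - T"
  have fW: "finite ?W" using I by simp
  let ?E = "\<lambda>F. bexp T p (\<lambda>a. bexp ?W p (\<lambda>w. bexp ?W p (\<lambda>w'. F a w w')))"
  \<comment> \<open>Off the bad points \<open>u\<close> equals \<open>g\<close>, and for values
    \<open>0\<close> and \<open>1\<close> the distance equals its square.\<close>
  have "?E (\<lambda>a w w'. \<bar>g (glue T a w) - g (glue T a w')\<bar>)
    \<le> ?E (\<lambda>a w w'. of_bool (bad (glue T a w)) + of_bool (bad (glue T a w')) +
        (u (glue T a w) - u (glue T a w'))\<^sup>2)"
  proof (intro bexp_mono T fW)
    fix a w w'
    let ?x = "glue T a w" and ?y = "glue T a w'"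
    show "\<bar>g ?x - g ?y\<bar> \<le> of_bool (bad ?x) + of_bool (bad ?y) + (u ?x - u ?y)\<^sup>2"
    proof (cases "bad ?x \<or> bad ?y")
      case True
      have "\<bar>g ?x - g ?y\<bar> \<le> 1" using g[of ?x] g[of ?y] by auto
      also have "1 \<le> of_bool (bad ?x) + (of_bool (bad ?y) :: real)" using True by auto
      finally show ?thesis by (simp add: add_increasing2)
    next
      case False
      hence "u ?x = g ?x" "u ?y = g ?y" using u_g by auto
      thus ?thesis using g[of ?x] g[of ?y] False by auto
    qed
  qed
  also have "\<dots> = 2 * B + ?E (\<lambda>a w w'. (u (glue T a w) - u (glue T a w'))\<^sup>2)"
  proof -
    have "B = bexp T p (\<lambda>a. bexp ?W p (\<lambda>w. of_bool (bad (glue T a w))))"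
      unfolding B_def by (rule bexp_glue[OF I T(1)])
    thus ?thesis by (simp add: bexp_add bexp_cmult T fW)
  qed
  also have "\<dots> \<le> 2 * B + 2 * (\<Sum>i\<in>?W. p * (1 - p) * bexp I p (\<lambda>x. (cdiff i u x)\<^sup>2))"
    using bexp_poincare_outside[OF I T(1) less_imp_le[OF p(1)] less_imp_le[OF p(2)], of u] by linarith
  also have "\<dots> \<le> 2 * (6 * \<eta> / \<zeta>) + 2 * (54 * \<eta> / \<zeta> ^ 3 + 576 / \<zeta> ^ 4 * \<tau> powr (\<zeta> / 6))"
  proof -
    have "(\<Sum>i\<in>?W. p * (1 - p) * bexp I p (\<lambda>x. (cdiff i u x)\<^sup>2)) \<le> (\<Sum>i\<in>?W. p * 1 * bexp I p (\<lambda>x. (cdiff i u x)\<^sup>2))"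
      using p by (intro sum_mono mult_right_mono mult_left_mono) (auto simp: bexp_nonneg I)
    also have "\<dots> = p * (\<Sum>i\<in>?W. bexp I p (\<lambda>x. (cdiff i u x)\<^sup>2))" by (simp add: sum_distrib_left)
    also note inf
    finally show ?thesis by (intro add_mono mult_left_mono B) auto
  qed
  also have "\<dots> \<le> 120 * \<eta> / \<zeta> ^ 3 + 1152 / \<zeta> ^ 4 * \<tau> powr (\<zeta> / 6)"
  proof -
    have "0 \<le> bexp I p (\<lambda>x. \<bar>thin (1/2) I f x - lam * g x\<bar>)" by (rule bexp_nonneg[OF I]) simp
    hence "0 \<le> \<eta>" using eta by linarith
    moreover have "\<zeta> ^ 3 \<le> \<zeta> ^ 1" using z by (intro power_decreasing) auto
    ultimately have "12 * \<eta> / \<zeta> \<le> 12 * \<eta> / \<zeta> ^ 3" using z by (intro divide_left_mono) auto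
    thus ?thesis by simp
  qed
  finally show ?thesis using that[OF T(1) cT] by simp
qed

subsection \<open>Solutions on a bounded cube\<close>

lemma sum_Pow_insert:
  assumes "finite A" "a \<notin> A"
  shows "sum h (Pow (insert a A)) = sum h (Pow A) + (\<Sum>X\<in>Pow A. h (insert a X))"
proof -
  have "sum h (Pow (insert a A)) = sum h (Pow A) + sum h (insert a ` Pow A)"
    unfolding Pow_insert using assms by (intro sum.union_disjoint) auto
  also have "sum h (insert a ` Pow A) = (\<Sum>X\<in>Pow A. h (insert a X))"
    using assms by (subst sum.reindex) (auto simp: inj_on_def insert_ident intro!: insert_ident[THEN iffD1])
  finally show ?thesis .
qed

lemma sum_Pow_power_card:
  fixes c :: "'b::comm_ring_1"
  assumes "finite A"
  shows "(\<Sum>X\<in>Pow A. c ^ card X) = (1 + c) ^ card A"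
  using assms
proof (induction A rule: finite_induct)
  case (insert a A)
  have "(\<Sum>X\<in>Pow A. c ^ card (insert a X)) = (\<Sum>X\<in>Pow A. c * c ^ card X)"
  proof (rule sum.cong)
    fix X assume "X \<in> Pow A"
    hence "finite X" "a \<notin> X" using insert.hyps finite_subset by auto
    thus "c ^ card (insert a X) = c * c ^ card X" by simp
  qed simp
  thus ?case
    using insert by (simp add: sum_Pow_insert sum_distrib_left[symmetric] algebra_simps)
qed simp

lemma minus_one_power_card_Int:
  assumes "finite A"
  shows "(-1) ^ card A * (-1) ^ card (A - y) = ((-1) ^ card (A \<inter> y) :: real)"
proof -
  have "card A = card (A \<inter> y) + card (A - y)"
    using assms card_Int_Diff by blast
  thus ?thesis by (simp add: power_add mult.assoc power_mult_distrib[symmetric])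
qed

text \<open>A nonnegative \<open>N\<close> is a measure on subsets of \<open>T\<close> under which a random set avoids \<open>K\<close>
  with probability \<open>2 powr (- card K)\<close> or \<open>0\<close>. The minimal sets \<open>K\<close> that are never avoided are
  hit by an odd number of elements almost surely; if two of them intersected, a third one inside
  their symmetric difference would be hit by an even number of elements.\<close>

lemma disjoint_obstructions:
  fixes N \<gamma> :: "nat set \<Rightarrow> real"
  assumes T: "finite T" and N: "\<And>X. X \<subseteq> T \<Longrightarrow> 0 \<le> N X"
    and sumN: "\<And>X. X \<subseteq> T \<Longrightarrow> sum N (Pow X) = 2 ^ card X * \<gamma> X"
    and \<gamma>: "\<And>X. X \<subseteq> T \<Longrightarrow> \<gamma> X \<in> {0, 1}" and nz: "X0 \<subseteq> T" "\<gamma> X0 \<noteq> 0"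
  obtains P where "disjoint P" "{} \<notin> P" "\<Union>P \<subseteq> T"
    "\<And>X. X \<subseteq> T \<Longrightarrow> \<gamma> X = of_bool (\<forall>A\<in>P. A \<inter> X \<noteq> {})"
proof -
  have fin: "finite X" if "X \<subseteq> T" for X using that T finite_subset by blast
  have mono: "\<gamma> Y = 1" if "\<gamma> X \<noteq> 0" "X \<subseteq> Y" "Y \<subseteq> T" for X Y
  proof -
    have "\<gamma> X = 1" using \<gamma>[of X] that by auto
    hence "0 < sum N (Pow X)" using sumN[of X] that by simp
    also have "\<dots> \<le> sum N (Pow Y)"
      using that fin[of Y] N by (intro sum_mono2) auto
    finally have "0 < 2 ^ card Y * \<gamma> Y" using sumN[of Y] that by simp
    hence "\<gamma> Y \<noteq> 0" by auto
    thus ?thesis using \<gamma>[of Y] that by auto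
  qed
  have gT: "\<gamma> T = 1" using mono nz by blast
  \<comment> \<open>The sets met by every set of positive weight: as \<open>N\<close> is
    nonnegative, \<open>\<gamma> (T - K) = 0\<close> says that \<open>N\<close> vanishes on all
    subsets of \<open>T - K\<close>.\<close>
  define Z where "Z = {K. K \<subseteq> T \<and> \<gamma> (T - K) = 0}"
  define P where "P = {K \<in> Z. \<forall>K'. K' \<subset> K \<longrightarrow> K' \<notin> Z}"
  have minimal: "\<exists>A\<in>P. A \<subseteq> K" if "K \<in> Z" for K
  proof -
    have "finite K" using that fin by (auto simp: Z_def)
    thus ?thesis using that
    proof (induction K rule: finite_psubset_induct)
      case (psubset K)
      show ?case
      proof (cases "\<exists>K'. K' \<subset> K \<and> K' \<in> Z")
        case True
        then obtain K' where K': "K' \<subset> K" "K' \<in> Z" by blast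
        from psubset.IH[OF this] K'(1) show ?thesis by blast
      next
        case False
        thus ?thesis using psubset.prems by (auto simp: P_def)
      qed
    qed
  qed
  have PT: "A \<subseteq> T" if "A \<in> P" for A using that by (auto simp: P_def Z_def)
  \<comment> \<open>Expanding \<open>(-1) ^ card (S - y)\<close> as the sum of
    \<open>(-2) ^ card K\<close> over \<open>K \<subseteq> S - y\<close> leaves total weights of the
    sets avoiding \<open>K\<close>, which are known; the powers of two combine to
    \<open>2 ^ card T\<close>.\<close>
  have char_sum: "(\<Sum>y\<in>Pow T. N y * (-1) ^ card (S - y))
      = 2 ^ card T * (\<Sum>K\<in>Pow S. (-1) ^ card K * \<gamma> (T - K))" if S: "S \<subseteq> T" for S
  proof -
    have fS: "finite S" by (rule fin[OF S])
    have "(\<Sum>y\<in>Pow T. N y * (-1) ^ card (S - y))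
      = (\<Sum>y\<in>Pow T. \<Sum>K\<in>Pow S. if K \<inter> y = {} then N y * (-2) ^ card K else 0)"
    proof (rule sum.cong[OF refl])
      fix y
      have "N y * (-1) ^ card (S - y) = N y * (\<Sum>K\<in>Pow (S - y). (-2) ^ card K)"
        using sum_Pow_power_card[of "S - y" "-2::real"] fS by simp
      also have "\<dots> = (\<Sum>K\<in>Pow (S - y). N y * (-2) ^ card K)" by (rule sum_distrib_left)
      also have "\<dots> = (\<Sum>K\<in>Pow S. if K \<inter> y = {} then N y * (-2) ^ card K else 0)"
        using fS by (intro sum.mono_neutral_cong_left) auto
      finally show "N y * (-1) ^ card (S - y) = \<dots>" .
    qed
    also have "\<dots> = (\<Sum>K\<in>Pow S. \<Sum>y\<in>Pow T. if K \<inter> y = {} then N y * (-2) ^ card K else 0)"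
      by (rule sum.swap)
    also have "\<dots> = (\<Sum>K\<in>Pow S. 2 ^ card T * ((-1) ^ card K * \<gamma> (T - K)))"
    proof (rule sum.cong[OF refl])
      fix K assume "K \<in> Pow S"
      hence K: "K \<subseteq> T" using S by auto
      have "(\<Sum>y\<in>Pow T. if K \<inter> y = {} then N y * (-2) ^ card K else 0)
        = (\<Sum>y\<in>Pow (T - K). N y * (-2) ^ card K)"
        using T by (intro sum.mono_neutral_cong_right) auto
      also have "\<dots> = 2 ^ card (T - K) * \<gamma> (T - K) * (-2) ^ card K"
        by (simp add: sum_distrib_right[symmetric] sumN)
      also have "\<dots> = 2 ^ (card (T - K) + card K) * ((-1) ^ card K * \<gamma> (T - K))"
      proof -
        have "(-2::real) ^ card K = (-1) ^ card K * 2 ^ card K"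
          by (simp flip: power_mult_distrib)
        thus ?thesis by (simp add: power_add)
      qed
      also have "card (T - K) + card K = card T"
        using K T by (simp add: card_Diff_subset fin card_mono)
      finally show "(\<Sum>y\<in>Pow T. if K \<inter> y = {} then N y * (-2) ^ card K else 0)
        = 2 ^ card T * ((-1) ^ card K * \<gamma> (T - K))" .
    qed
    finally show ?thesis by (simp add: sum_distrib_left)
  qed
  have alt: "(\<Sum>K\<in>Pow S. (-1::real) ^ card K) = 0" if "S \<subseteq> T" "S \<noteq> {}" for S
    using sum_Pow_power_card[of S "-1::real"] fin[OF that(1)] that by (simp add: card_gt_0_iff)
  have total: "sum N (Pow T) = 2 ^ card T" using sumN[of T] gT by simp
  have ne: "{} \<notin> P" using gT by (auto simp: P_def Z_def)
  \<comment> \<open>By minimality all proper subsets of \<open>A\<close> can be avoided, so the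
    alternating sum lacks exactly its top term. The weighted mean of
    \<open>(-1) ^ card (A \<inter> y)\<close> is then \<open>-1\<close>, the extreme value, which
    forces this sign wherever \<open>N\<close> is positive.\<close>
  have odd: "odd (card (A \<inter> y))" if A: "A \<in> P" and y: "y \<subseteq> T" "N y \<noteq> 0" for A y
  proof -
    have AT: "A \<subseteq> T" "A \<noteq> {}" and fA: "finite A" using PT[OF A] fin ne A by auto
    have "(\<Sum>K\<in>Pow A. (-1) ^ card K * \<gamma> (T - K)) = (\<Sum>K\<in>Pow A - {A}. (-1) ^ card K * \<gamma> (T - K))"
      using A fA by (intro sum.mono_neutral_right) (auto simp: P_def Z_def)
    also have "\<dots> = (\<Sum>K\<in>Pow A - {A}. (-1) ^ card K)"
    proof (rule sum.cong[OF refl])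
      fix K assume "K \<in> Pow A - {A}"
      hence "K \<subset> A" by auto
      hence "\<gamma> (T - K) \<noteq> 0" using A AT by (auto simp: P_def Z_def)
      thus "(-1) ^ card K * \<gamma> (T - K) = (-1) ^ card K" using \<gamma>[of "T - K"] by auto
    qed
    also have "\<dots> = - ((-1) ^ card A)"
      using alt[OF AT] fA by (simp add: sum_diff1)
    finally have s: "(\<Sum>y\<in>Pow T. N y * (-1) ^ card (A - y)) = - (2 ^ card T * (-1) ^ card A)"
      using char_sum[OF AT(1)] by simp
    have "(\<Sum>y\<in>Pow T. N y * ((-1) ^ card (A \<inter> y) + 1))
      = (-1) ^ card A * (\<Sum>y\<in>Pow T. N y * (-1) ^ card (A - y)) + sum N (Pow T)"
      by (simp add: minus_one_power_card_Int[OF fA, symmetric] sum.distrib sum_distrib_left algebra_simps)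
    also have "\<dots> = 0" unfolding s total
      by (simp add: mult.left_commute flip: power_add)
    finally have z: "(\<Sum>y\<in>Pow T. N y * ((-1) ^ card (A \<inter> y) + 1)) = 0" .
    have nn: "0 \<le> N y * ((-1) ^ card (A \<inter> y) + 1)" if "y \<in> Pow T" for y
      using N[of y] that by (cases "even (card (A \<inter> y))") auto
    have "N y * ((-1) ^ card (A \<inter> y) + 1) = 0"
      using z nn T y by (subst (asm) sum_nonneg_eq_0_iff) auto
    thus ?thesis using y by (cases "even (card (A \<inter> y))") auto
  qed
  obtain y0 where y0: "y0 \<subseteq> T" "N y0 \<noteq> 0"
  proof -
    have "sum N (Pow T) \<noteq> 0" using total by simp
    then obtain y where "y \<in> Pow T" "N y \<noteq> 0" by (meson sum.not_neutral_contains_not_neutral)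
    thus ?thesis using that by auto
  qed
  have disj: "A \<inter> B = {}" if "A \<in> P" "B \<in> P" "A \<noteq> B" for A B
  proof (rule ccontr)
    assume "A \<inter> B \<noteq> {}"
    hence "(\<lambda>p. fst p \<in> P \<and> snd p \<in> P \<and> fst p \<noteq> snd p \<and> fst p \<inter> snd p \<noteq> {}) (A, B)"
      using that by simp
    \<comment> \<open>An intersecting pair with smallest union, so that pairs formed with a third
      set inside the symmetric difference can be compared with it.\<close>
    from ex_has_least_nat[where P = "\<lambda>p. fst p \<in> P \<and> snd p \<in> P \<and> fst p \<noteq> snd p \<and> fst p \<inter> snd p \<noteq> {}",
        OF this, of "\<lambda>p. card (fst p \<union> snd p)"]
    obtain p where p: "fst p \<in> P \<and> snd p \<in> P \<and> fst p \<noteq> snd p \<and> fst p \<inter> snd p \<noteq> {}"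
      and pmin: "\<And>r. fst r \<in> P \<and> snd r \<in> P \<and> fst r \<noteq> snd r \<and> fst r \<inter> snd r \<noteq> {} \<Longrightarrow>
        card (fst p \<union> snd p) \<le> card (fst r \<union> snd r)"
      by blast
    define A1 where "A1 = fst p"
    define A2 where "A2 = snd p"
    have A12: "A1 \<in> P" "A2 \<in> P" "A1 \<noteq> A2" "A1 \<inter> A2 \<noteq> {}" using p by (auto simp: A1_def A2_def)
    have least: "card (A1 \<union> A2) \<le> card (B1 \<union> B2)"
      if "B1 \<in> P" "B2 \<in> P" "B1 \<noteq> B2" "B1 \<inter> B2 \<noteq> {}" for B1 B2
      using pmin[of "(B1, B2)"] that by (simp add: A1_def A2_def)
    have sub: "A1 \<subseteq> T" "A2 \<subseteq> T" using PT A12 by auto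
    hence f12: "finite A1" "finite A2" using fin by auto
    define D where "D = (A1 - A2) \<union> (A2 - A1)"
    have DT: "D \<subseteq> T" "D \<noteq> {}" using sub A12 by (auto simp: D_def)
    have even: "even (card (D \<inter> y))" if y: "y \<subseteq> T" "N y \<noteq> 0" for y
    proof -
      have c1: "card (A1 \<inter> y) = card ((A1 - A2) \<inter> y) + card (A1 \<inter> A2 \<inter> y)"
        using f12 by (subst card_Un_disjoint[symmetric]) (auto intro: arg_cong[of _ _ card])
      have c2: "card (A2 \<inter> y) = card ((A2 - A1) \<inter> y) + card (A1 \<inter> A2 \<inter> y)"
        using f12 by (subst card_Un_disjoint[symmetric]) (auto intro: arg_cong[of _ _ card])
      have c3: "card (D \<inter> y) = card ((A1 - A2) \<inter> y) + card ((A2 - A1) \<inter> y)"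
        using f12 by (subst card_Un_disjoint[symmetric]) (auto simp: D_def intro: arg_cong[of _ _ card])
      show ?thesis using odd[OF A12(1) y] odd[OF A12(2) y] unfolding c1 c2 c3 by presburger
    qed
    have "(\<Sum>y\<in>Pow T. N y * (-1) ^ card (D - y)) = (\<Sum>y\<in>Pow T. N y * (-1) ^ card D)"
    proof (rule sum.cong[OF refl])
      fix y assume y: "y \<in> Pow T"
      show "N y * (-1) ^ card (D - y) = N y * (-1) ^ card D"
      proof (cases "N y = 0")
        case False
        have "card D = card (D \<inter> y) + card (D - y)"
          using fin[OF DT(1)] card_Int_Diff by blast
        thus ?thesis using even[of y] y False by (simp add: power_add)
      qed simp
    qed
    also have "\<dots> = 2 ^ card T * (-1) ^ card D" by (simp add: sum_distrib_right[symmetric] total)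
    finally have nzD: "(\<Sum>K\<in>Pow D. (-1) ^ card K * \<gamma> (T - K)) \<noteq> 0"
      using char_sum[OF DT(1)] by auto
    have "\<exists>K. K \<subseteq> D \<and> K \<in> Z"
    proof (rule ccontr)
      assume "\<nexists>K. K \<subseteq> D \<and> K \<in> Z"
      hence "\<gamma> (T - K) = 1" if "K \<subseteq> D" for K
        using that DT \<gamma>[of "T - K"] by (auto simp: Z_def)
      hence "(\<Sum>K\<in>Pow D. (-1) ^ card K * \<gamma> (T - K)) = (\<Sum>K\<in>Pow D. (-1) ^ card K)"
        by (intro sum.cong) auto
      thus False using nzD alt[OF DT] by simp
    qed
    then obtain C where C: "C \<in> P" "C \<subseteq> D" using minimal by (meson order_trans)
    \<comment> \<open>Minimality makes \<open>C\<close> meet both one-sided differences, hence both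
      \<open>A1\<close> and \<open>A2\<close>; the smallest union then forces \<open>C\<close> to
      contain both differences. So \<open>C = D\<close> would be met in an odd and in an even number
      of elements.\<close>
    have "\<not> C \<subset> A1" "\<not> C \<subset> A2" using A12 C by (auto simp: P_def)
    hence meet: "C \<inter> (A2 - A1) \<noteq> {}" "C \<inter> (A1 - A2) \<noteq> {}"
      using C(2) A12(4) unfolding D_def by blast+
    have "card (A1 \<union> A2) \<le> card (C \<union> A1)" "card (A1 \<union> A2) \<le> card (C \<union> A2)"
      using meet A12 C by (intro least; auto simp: D_def)+
    moreover have "C \<union> A1 \<subseteq> A1 \<union> A2" "C \<union> A2 \<subseteq> A1 \<union> A2" using C(2) by (auto simp: D_def)
    ultimately have "C \<union> A1 = A1 \<union> A2" "C \<union> A2 = A1 \<union> A2"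
      using f12 by (intro card_seteq; simp)+
    hence "C = D" using C(2) unfolding D_def by blast
    thus False using odd[OF C(1) y0] even[OF y0] by simp
  qed
  have "\<gamma> X = of_bool (\<forall>A\<in>P. A \<inter> X \<noteq> {})" if X: "X \<subseteq> T" for X
  proof (cases "\<gamma> X = 0")
    case True
    have "T - (T - X) = X" using X by blast
    hence "T - X \<in> Z" using True by (simp add: Z_def)
    then obtain A where "A \<in> P" "A \<subseteq> T - X" using minimal by blast
    hence "A \<in> P" "A \<inter> X = {}" by auto
    thus ?thesis using True by auto
  next
    case False
    have "A \<inter> X \<noteq> {}" if "A \<in> P" for A
    proof
      assume "A \<inter> X = {}"
      hence "\<gamma> (T - A) = 1" using mono[OF False, of "T - A"] X by blast
      thus False using that by (auto simp: P_def Z_def)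
    qed
    thus ?thesis using False \<gamma>[OF X] by auto
  qed
  moreover have "disjoint P" using disj by (auto simp: pairwise_def disjnt_def)
  moreover have "\<Union>P \<subseteq> T" using PT by blast
  ultimately show ?thesis using that[of P] ne by blast
qed

section \<open>Averages of conjunctions of parities\<close>

lemma and_xor_insert:
  "and_xor (insert A P) x = (1 - (-1) ^ card {j\<in>A. x j}) / 2 * and_xor P x"
  by (auto simp: and_xor_def)

lemma and_xor_cong: "(\<And>A j. A \<in> P \<Longrightarrow> j \<in> A \<Longrightarrow> x j = y j) \<Longrightarrow> and_xor P x = and_xor P y"
  unfolding and_xor_def by (intro arg_cong[of _ _ of_bool] ball_cong refl arg_cong[of _ _ odd]
    arg_cong[of _ _ card]) auto

text \<open>The signs of independent bits multiply, each with mean \<open>1 - 2 * q\<close>, and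
  \<open>H\<close> is independent of the bits in \<open>A\<close>.\<close>

lemma bexp_parity:
  assumes "finite I" "A \<subseteq> I" "0 \<le> q" "q \<le> 1" "\<And>x j c. j \<in> A \<Longrightarrow> H (x(j := c)) = H x"
  shows "bexp I q (\<lambda>z. (-1) ^ card {j\<in>A. z j} * H z) = (1 - 2 * q) ^ card A * bexp I q H"
proof -
  have "finite A" using assms finite_subset by blast
  thus ?thesis using assms(2,5)
  proof (induction A rule: finite_induct)
    case (insert a A)
    let ?G = "\<lambda>z. (-1) ^ card {j\<in>A. z j} * H z"
    have G: "?G (z(a := c)) = ?G z" for z c
    proof -
      have "{j\<in>A. (z(a := c)) j} = {j\<in>A. z j}" using insert.hyps by auto
      moreover have "H (z(a := c)) = H z" by (rule insert.prems(2)) simp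
      ultimately show ?thesis by (simp only:)
    qed
    have "(-1) ^ card {j\<in>insert a A. z j} * H z = ?G z - 2 * (of_bool (z a) * ?G z)" for z
    proof (cases "z a")
      case True
      hence "{j\<in>insert a A. z j} = insert a {j\<in>A. z j}" by auto
      thus ?thesis using True insert.hyps by simp
    next
      case False
      hence "{j\<in>insert a A. z j} = {j\<in>A. z j}" by auto
      thus ?thesis using False by simp
    qed
    hence "bexp I q (\<lambda>z. (-1) ^ card {j\<in>insert a A. z j} * H z)
      = bexp I q ?G - 2 * bexp I q (\<lambda>z. of_bool (z a) * ?G z)"
      by (simp only: bexp_diff[OF assms(1)] bexp_cmult)
    also have "bexp I q (\<lambda>z. of_bool (z a) * ?G z) = q * bexp I q ?G"
      by (rule bexp_coord[OF assms(1)]) (use insert.prems assms G in auto)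
    also have "bexp I q ?G = (1 - 2 * q) ^ card A * bexp I q H"
      using insert.prems by (intro insert.IH) auto
    finally show ?case using insert.hyps by (simp add: algebra_simps)
  qed simp
qed

text \<open>Only the ones of \<open>x\<close> in \<open>A\<close> remain random, which gives the
  mean sign of the parity on \<open>A\<close>; disjoint parts are independent. The case
  \<open>q = 1/2\<close> yields ORs, and \<open>x\<close> constantly true yields plain
  means.\<close>

lemma bexp_and_xor_thin:
  assumes "finite I" "finite P" "disjoint P" "\<Union>P \<subseteq> I" "0 \<le> q" "q \<le> 1"
  shows "thin q I (and_xor P) x = (\<Prod>A\<in>P. (1 - (1 - 2 * q) ^ card {j\<in>A. x j}) / 2)"
  using assms(2-4)
proof (induction P rule: finite_induct)
  case empty
  show ?case by (simp add: thin_def and_xor_def)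
next
  case (insert A P)
  define B where "B = {j\<in>A. x j}"
  let ?H = "\<lambda>z. and_xor P (\<lambda>i. x i \<and> z i)"
  have dj: "A \<inter> A' = {}" if "A' \<in> P" for A'
    using insert.prems(1) insert.hyps that by (auto simp: pairwise_def disjnt_def)
  have H: "?H (z(j := c)) = ?H z" if "j \<in> B" for z j c
    by (rule and_xor_cong) (use that dj in \<open>auto simp: B_def\<close>)
  have "and_xor (insert A P) (\<lambda>i. x i \<and> z i) = 1/2 * (?H z - (-1) ^ card {j\<in>B. z j} * ?H z)" for z
    by (simp add: and_xor_insert B_def left_diff_distrib diff_divide_distrib)
  hence "thin q I (and_xor (insert A P)) x
    = 1/2 * (bexp I q ?H - bexp I q (\<lambda>z. (-1) ^ card {j\<in>B. z j} * ?H z))"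
    unfolding thin_def by (simp only: bexp_cmult bexp_diff[OF assms(1)])
  also have "bexp I q (\<lambda>z. (-1) ^ card {j\<in>B. z j} * ?H z) = (1 - 2 * q) ^ card B * bexp I q ?H"
    by (rule bexp_parity) (use assms insert.prems H in \<open>auto simp: B_def\<close>)
  also have "bexp I q ?H = (\<Prod>A\<in>P. (1 - (1 - 2 * q) ^ card {j\<in>A. x j}) / 2)"
    using insert.IH insert.prems by (simp add: thin_def pairwise_insert)
  finally show ?case using insert.hyps by (simp add: B_def algebra_simps)
qed

lemma bexp_and_xor:
  assumes "finite I" "finite P" "disjoint P" "\<Union>P \<subseteq> I" "0 \<le> q" "q \<le> 1"
  shows "bexp I q (and_xor P) = (\<Prod>A\<in>P. (1 - (1 - 2 * q) ^ card A) / 2)"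
  using bexp_and_xor_thin[OF assms, of "\<lambda>_. True"] by (simp add: thin_def)

text \<open>A uniform subset of a nonempty set has odd size with probability one half, of the empty
  set never. These are the exact solutions that the classification recovers.\<close>

lemma thin_half_and_xor:
  assumes "finite I" "finite P" "disjoint P" "\<Union>P \<subseteq> I"
  shows "thin (1/2) I (and_xor P) x = and_or P x / 2 ^ card P"
proof -
  have fA: "finite A" if "A \<in> P" for A
  proof (rule finite_subset[OF _ assms(1)])
    show "A \<subseteq> I" using assms(4) that by blast
  qed
  have "thin (1/2) I (and_xor P) x = (\<Prod>A\<in>P. of_bool (\<exists>j\<in>A. x j) / 2)"
    unfolding bexp_and_xor_thin[OF assms, of "1/2", simplified]
  proof (rule prod.cong[OF refl])
    fix A assume A: "A \<in> P"
    \<comment> \<open>At \<open>q = 1/2\<close> the base is zero, and \<open>0 ^ 0 = 1\<close>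
      singles out the parts without ones.\<close>
    have "card {j\<in>A. x j} = 0 \<longleftrightarrow> \<not> (\<exists>j\<in>A. x j)" using fA[OF A] by auto
    thus "(1 - 0 ^ card {j\<in>A. x j}) / 2 = (of_bool (\<exists>j\<in>A. x j) / 2 :: real)"
      by (cases "\<exists>j\<in>A. x j") (auto simp: power_0_left)
  qed
  also have "\<dots> = (\<Prod>A\<in>P. of_bool (\<exists>j\<in>A. x j)) / 2 ^ card P" by (simp add: prod_dividef)
  also have "(\<Prod>A\<in>P. of_bool (\<exists>j\<in>A. x j)) = and_or P x"
    using assms(2) by (auto simp: and_or_def)
  finally show ?thesis .
qed

lemma bexp_half:
  assumes "finite X"
  shows "bexp X (1/2) h = (\<Sum>Y\<in>Pow X. h (\<lambda>i. i \<in> Y)) / 2 ^ card X"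
  using assms
proof (induction X arbitrary: h rule: finite_induct)
  case (insert a X)
  have 1: "(\<Sum>Y\<in>Pow X. h ((\<lambda>i. i \<in> Y)(a := True))) = (\<Sum>Y\<in>Pow X. h (\<lambda>i. i \<in> insert a Y))"
    by (intro sum.cong refl arg_cong[of _ _ h] ext) auto
  have 2: "(\<Sum>Y\<in>Pow X. h ((\<lambda>i. i \<in> Y)(a := False))) = (\<Sum>Y\<in>Pow X. h (\<lambda>i. i \<in> Y))"
    using insert.hyps by (intro sum.cong refl arg_cong[of _ _ h] ext) auto
  have "bexp (insert a X) (1/2) h = 1/2 * ((\<Sum>Y\<in>Pow X. h (\<lambda>i. i \<in> insert a Y)) / 2 ^ card X)
      + 1/2 * ((\<Sum>Y\<in>Pow X. h (\<lambda>i. i \<in> Y)) / 2 ^ card X)"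
    using insert.hyps by (simp add: bexp_insert insert.IH 1 2)
  thus ?case using insert.hyps by (simp add: sum_Pow_insert add_divide_distrib)
qed simp

text \<open>Moebius inversion makes \<open>\<phi> / lam\<close> integral up to the error, so small negative values of
  its integral approximation \<open>N\<close> are excluded and \<open>N\<close> is exactly nonnegative.\<close>

lemma approx_solution_structure:
  fixes \<phi> \<gamma> :: "(nat \<Rightarrow> bool) \<Rightarrow> real" and lam \<delta> :: real
  assumes T: "finite T" and \<phi>: "\<And>x. x \<in> cube T \<Longrightarrow> 0 \<le> \<phi> x"
    and \<gamma>: "\<And>x. x \<in> cube T \<Longrightarrow> \<gamma> x \<in> {0, 1}" and lam: "0 < lam"
    and close: "\<And>x. x \<in> cube T \<Longrightarrow> \<bar>thin (1/2) T \<phi> x - lam * \<gamma> x\<bar> \<le> \<delta>"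
    and small: "3 ^ card T * \<delta> < lam" and nz: "x0 \<in> cube T" "\<gamma> x0 \<noteq> 0"
  obtains P where "disjoint P" "{} \<notin> P" "\<Union>P \<subseteq> T"
    "\<And>x. x \<in> cube T \<Longrightarrow> \<gamma> x = and_or P x"
    "\<And>x. x \<in> cube T \<Longrightarrow> \<bar>\<phi> x - 2 ^ card P * lam * and_xor P x\<bar> \<le> 3 ^ card T * \<delta>"
proof -
  define ind where "ind = (\<lambda>X::nat set. \<lambda>i. i \<in> X)"
  have ind_cube: "ind X \<in> cube T" if "X \<subseteq> T" for X using that by (auto simp: ind_def cube_iff)
  have cube_ind: "x = ind {i. x i}" "{i. x i} \<subseteq> T" if "x \<in> cube T" for x
    using that by (auto simp: ind_def cube_iff)
  have fin: "finite X" if "X \<subseteq> T" for X using that T finite_subset by blast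
  have \<delta>: "0 \<le> \<delta>" using close[OF nz(1)] by linarith
  define G where "G = (\<lambda>X. sum (\<lambda>Y. \<phi> (ind Y)) (Pow X))"
  have thin_ind: "thin (1/2) T h (ind X) = (\<Sum>Y\<in>Pow X. h (ind Y)) / 2 ^ card X" if "X \<subseteq> T" for X h
    using thin_restrict[OF T ind_cube[OF that], of "1/2" h] bexp_half[OF fin[OF that], of h]
    by (simp add: ind_def)
  \<comment> \<open>The Moebius inverse of the error-free data: \<open>lam * N\<close> is what
    \<open>\<phi>\<close> would be if \<open>\<delta>\<close> were zero.\<close>
  define N where "N = (\<lambda>X. \<Sum>Y\<in>Pow X. (-1) ^ (card X - card Y) * (2 ^ card Y * \<gamma> (ind Y)))"
  have appr: "\<bar>\<phi> (ind X) - lam * N X\<bar> \<le> 3 ^ card T * \<delta>" if X: "X \<subseteq> T" for X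
  proof -
    have fX: "finite X" by (rule fin[OF X])
    have "\<phi> (ind X) = (\<Sum>Y\<in>Pow X. (-1) ^ (card X - card Y) * G Y)"
      by (rule inclusion_exclusion_mobius[OF _ fX]) (simp add: G_def)
    hence "\<phi> (ind X) - lam * N X
      = (\<Sum>Y\<in>Pow X. (-1) ^ (card X - card Y) * (G Y - lam * (2 ^ card Y * \<gamma> (ind Y))))"
      by (simp add: N_def sum_distrib_left sum_subtractf right_diff_distrib mult_ac)
    also have "\<bar>\<dots>\<bar> \<le> (\<Sum>Y\<in>Pow X. \<bar>(-1) ^ (card X - card Y) * (G Y - lam * (2 ^ card Y * \<gamma> (ind Y)))\<bar>)"
      by (rule sum_abs)
    also have "\<dots> \<le> (\<Sum>Y\<in>Pow X. 2 ^ card Y * \<delta>)"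
    proof (rule sum_mono)
      fix Y assume "Y \<in> Pow X"
      hence Y: "Y \<subseteq> T" using X by auto
      have "G Y = 2 ^ card Y * thin (1/2) T \<phi> (ind Y)"
        unfolding thin_ind[OF Y] by (simp add: G_def)
      hence "G Y - lam * (2 ^ card Y * \<gamma> (ind Y)) = 2 ^ card Y * (thin (1/2) T \<phi> (ind Y) - lam * \<gamma> (ind Y))"
        by (simp add: right_diff_distrib)
      thus "\<bar>(-1) ^ (card X - card Y) * (G Y - lam * (2 ^ card Y * \<gamma> (ind Y)))\<bar> \<le> 2 ^ card Y * \<delta>"
        using close[OF ind_cube[OF Y]] by (simp add: abs_mult power_abs)
    qed
    \<comment> \<open>The subset sums at \<open>Y\<close> carry an error
      \<open>2 ^ card Y * \<delta>\<close>; adding these over all subsets is the origin of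
      \<open>3 ^ card T\<close>.\<close>
    also have "\<dots> = 3 ^ card X * \<delta>"
      using sum_Pow_power_card[OF fX, of "2::real"] by (simp add: sum_distrib_right[symmetric])
    also have "\<dots> \<le> 3 ^ card T * \<delta>"
      using \<delta> X T by (intro mult_right_mono power_increasing card_mono) auto
    finally show ?thesis .
  qed
  have Nint: "N X \<in> \<int>" if "X \<subseteq> T" for X
    unfolding N_def
  proof (intro Ints_sum Ints_mult)
    fix Y assume "Y \<in> Pow X"
    hence "Y \<subseteq> T" using that by auto
    thus "\<gamma> (ind Y) \<in> \<int>" using \<gamma>[OF ind_cube[of Y]] by auto
  qed auto
  have N0: "0 \<le> N X" if X: "X \<subseteq> T" for X
  proof (rule ccontr)
    assume "\<not> 0 \<le> N X"
    moreover obtain k :: int where "N X = of_int k" using Nint[OF X] by (auto elim: Ints_cases)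
    ultimately have "N X \<le> -1" by simp
    hence "lam * N X \<le> lam * (-1)" using lam by (intro mult_left_mono) auto
    thus False using appr[OF X] \<phi>[OF ind_cube[OF X]] small by linarith
  qed
  have sumN: "sum N (Pow X) = 2 ^ card X * \<gamma> (ind X)" if X: "X \<subseteq> T" for X
  proof -
    let ?f = "\<lambda>Y. 2 ^ card Y * \<gamma> (ind Y)"
    have fX: "finite X" by (rule fin[OF X])
    have sgn: "(-1) ^ card Y * (\<Sum>U\<in>Pow Y. (-1) ^ card U * ?f U) = N Y" if "Y \<in> Pow X" for Y
    proof -
      have fY: "finite Y" using that fX finite_subset by auto
      have "(-1) ^ card Y * ((-1) ^ card U * ?f U) = (-1) ^ (card Y - card U) * ?f U" if "U \<in> Pow Y" for U
      proof -
        have "card U \<le> card Y" using that fY card_mono by auto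
        hence "card Y = (card Y - card U) + card U" by simp
        hence "(-1::real) ^ card Y = (-1) ^ (card Y - card U) * (-1) ^ card U" by (metis power_add)
        thus ?thesis by (simp add: mult.left_commute flip: power_mult_distrib mult.assoc)
      qed
      thus ?thesis unfolding N_def sum_distrib_left by (intro sum.cong) auto
    qed
    have "?f X = (\<Sum>Y\<in>Pow X. (-1) ^ card Y * (\<Sum>U\<in>Pow Y. (-1) ^ card U * ?f U))"
      by (rule inclusion_exclusion_symmetric[OF _ fX]) simp
    also have "\<dots> = sum N (Pow X)" using sgn by (intro sum.cong) auto
    finally show ?thesis by simp
  qed
  have g01: "\<gamma> (ind X) \<in> {0, 1}" if "X \<subseteq> T" for X using \<gamma>[OF ind_cube[OF that]] .
  have nz': "{i. x0 i} \<subseteq> T" "\<gamma> (ind {i. x0 i}) \<noteq> 0" using cube_ind[OF nz(1)] nz(2) by auto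
  obtain P where P: "disjoint P" "{} \<notin> P" "\<Union>P \<subseteq> T"
    "\<And>X. X \<subseteq> T \<Longrightarrow> \<gamma> (ind X) = of_bool (\<forall>A\<in>P. A \<inter> X \<noteq> {})"
    using disjoint_obstructions[OF T N0 sumN g01 nz'] by metis
  have fP: "finite P" using P(3) T by (meson finite_UnionD finite_subset)
  have gP: "\<gamma> (ind X) = and_or P (ind X)" if "X \<subseteq> T" for X
  proof -
    have "\<gamma> (ind X) = of_bool (\<forall>A\<in>P. A \<inter> X \<noteq> {})" by (rule P(4)[OF that])
    also have "\<dots> = and_or P (ind X)"
      unfolding and_or_def ind_def by (intro arg_cong[of _ _ of_bool]) auto
    finally show ?thesis .
  qed
  \<comment> \<open>Both functions have the same sums over all power sets, so Moebius inversion
    identifies them.\<close>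
  have NP: "N X = 2 ^ card P * and_xor P (ind X)" if X: "X \<subseteq> T" for X
  proof -
    let ?f = "\<lambda>Y. 2 ^ card P * and_xor P (ind Y)"
    have fX: "finite X" by (rule fin[OF X])
    have "?f X = (\<Sum>Y\<in>Pow X. (-1) ^ (card X - card Y) * sum ?f (Pow Y))"
      by (rule inclusion_exclusion_mobius[OF _ fX]) simp
    also have "\<dots> = N X"
      unfolding N_def
    proof (intro sum.cong refl arg_cong2[of _ _ _ _ "(*)"])
      fix Y assume "Y \<in> Pow X"
      hence Y: "Y \<subseteq> T" using X by auto
      have "sum ?f (Pow Y) = 2 ^ card P * (2 ^ card Y * thin (1/2) T (and_xor P) (ind Y))"
        unfolding thin_ind[OF Y] by (simp add: sum_distrib_left[symmetric])
      also have "\<dots> = 2 ^ card Y * \<gamma> (ind Y)"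
        unfolding thin_half_and_xor[OF T fP P(1,3)] gP[OF Y] by simp
      finally show "sum ?f (Pow Y) = 2 ^ card Y * \<gamma> (ind Y)" .
    qed
    finally show ?thesis by simp
  qed
  show ?thesis
  proof (rule that[OF P(1-3)])
    fix x assume x: "x \<in> cube T"
    note xi = cube_ind[OF x]
    show "\<gamma> x = and_or P x" using gP[OF xi(2)] xi(1) by simp
    show "\<bar>\<phi> x - 2 ^ card P * lam * and_xor P x\<bar> \<le> 3 ^ card T * \<delta>"
      using appr[OF xi(2)] NP[OF xi(2)] xi(1) by (simp add: mult_ac)
  qed
qed

section \<open>Measures of elementary events\<close>

lemma bexp_subcube:
  assumes "finite I" "B \<subseteq> I" "C \<subseteq> I" "B \<inter> C = {}" "0 < \<zeta>" "\<zeta> \<le> q" "q \<le> 1 - \<zeta>"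
    "card B + card C \<le> k"
  shows "\<zeta> ^ k \<le> bexp I q (\<lambda>x. of_bool ((\<forall>j\<in>B. \<not> x j) \<and> (\<forall>j\<in>C. x j)))"
proof -
  let ?h = "\<lambda>x. of_bool ((\<forall>j\<in>B. \<not> x j) \<and> (\<forall>j\<in>C. x j)) :: real"
  let ?J = "B \<union> C"
  have J: "?J \<subseteq> I" "finite ?J" using assms finite_subset by auto
  have "card ?J \<le> k" using card_Un_le[of B C] assms(8) by linarith
  hence "\<zeta> ^ k \<le> \<zeta> ^ card ?J * ?h (\<lambda>j. j \<in> C)"
    using assms by (auto intro: power_decreasing)
  also have "\<dots> \<le> bexp ?J q ?h"
    by (rule bexp_point[OF J(2)]) (use assms in \<open>auto simp: cube_iff\<close>)
  also have "\<dots> = bexp I q ?h"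
    by (rule bexp_not_dep[symmetric, OF assms(1) J(1)]) auto
  finally show ?thesis .
qed

lemma bexp_all_zero:
  assumes "finite I" "A \<subseteq> I" "0 \<le> q" "q \<le> 1"
  shows "bexp I q (\<lambda>x. of_bool (\<forall>j\<in>A. \<not> x j)) = (1 - q) ^ card A"
proof -
  have "finite A" using assms finite_subset by blast
  have "bexp I q (\<lambda>x. of_bool (\<forall>j\<in>A. \<not> x j)) = bexp A q (\<lambda>x. of_bool (\<forall>j\<in>A. \<not> x j))"
    by (rule bexp_not_dep[OF assms(1,2)]) auto
  also have "\<dots> = (1 - q) ^ card A"
    using \<open>finite A\<close>
  proof (induction A rule: finite_induct)
    case (insert a A)
    have "(\<forall>j\<in>insert a A. \<not> (x(a := False)) j) \<longleftrightarrow> (\<forall>j\<in>A. \<not> x j)" for x :: "nat \<Rightarrow> bool"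
      using insert.hyps by auto
    thus ?case using insert assms by (simp add: bexp_insert)
  qed simp
  finally show ?thesis .
qed

subsection \<open>Small and large parts\<close>

lemma bexp_exists_le:
  assumes "finite I" "bexp I q h \<le> c"
  obtains x where "x \<in> cube I" "h x \<le> c"
proof (rule ccontr)
  assume "\<not> thesis"
  hence gt: "c < h x" if "x \<in> cube I" for x using that \<open>\<And>x. x \<in> cube I \<Longrightarrow> h x \<le> c \<Longrightarrow> thesis\<close> by force
  let ?M = "Min (h ` cube I)"
  have ne: "h ` cube I \<noteq> {}" "finite (h ` cube I)"
    using assms(1) by (auto simp: cube_iff intro: exI[of _ "\<lambda>_. False"])
  have "c < ?M" using ne gt by (subst Min_gr_iff) auto
  also have "?M = bexp I q (\<lambda>_. ?M)" by simp
  also have "\<dots> \<le> bexp I q h" using ne by (intro bexp_mono assms(1)) auto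
  finally show False using assms(2) by simp
qed

lemma one_minus_prod_le:
  fixes x :: "'b \<Rightarrow> real"
  assumes "finite S" "\<And>i. i \<in> S \<Longrightarrow> 0 \<le> x i" "\<And>i. i \<in> S \<Longrightarrow> x i \<le> 1"
  shows "1 - (\<Prod>i\<in>S. 1 - x i) \<le> (\<Sum>i\<in>S. x i)"
  using assms
proof (induction S rule: finite_induct)
  case (insert a S)
  have "(\<Prod>i\<in>S. 1 - x i) \<le> 1" using insert by (intro prod_le_1) auto
  hence "x a * (\<Prod>i\<in>S. 1 - x i) \<le> x a * 1" using insert by (intro mult_left_mono) auto
  moreover have "1 - (\<Prod>i\<in>S. 1 - x i) \<le> (\<Sum>i\<in>S. x i)" using insert by auto
  ultimately show ?case using insert by (simp add: left_diff_distrib)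
qed simp

lemma disjoint_transversal:
  assumes "disjoint P" "\<And>A. A \<in> P \<Longrightarrow> c A \<in> A" "A \<in> P"
  shows "{j\<in>A. j \<in> c ` P} = {c A}"
  using assms by (fastforce simp: pairwise_def disjnt_def)

text \<open>One element from each part makes every parity odd. Evaluating a solution there bounds
  \<open>2 ^ card P * lam\<close>.\<close>

lemma and_xor_transversal:
  assumes "disjoint P" "{} \<notin> P" "\<Union>P \<subseteq> T"
  obtains x where "x \<in> cube T" "and_xor P x = 1"
proof -
  have "\<forall>A\<in>P. \<exists>j. j \<in> A" using assms(2) by (metis ex_in_conv)
  then obtain c where c: "\<And>A. A \<in> P \<Longrightarrow> c A \<in> A" by metis
  have "and_xor P (\<lambda>j. j \<in> c ` P) = 1"
    unfolding and_xor_def using disjoint_transversal[OF assms(1) c] by simp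
  moreover have "(\<lambda>j. j \<in> c ` P) \<in> cube T" using c assms(3) by (auto simp: cube_iff)
  ultimately show ?thesis using that by blast
qed

text \<open>Zeros on \<open>B\<close> and a one in each part, chosen outside \<open>B\<close>, fix
  at most \<open>k\<close> coordinates and give a subcube on which \<open>h\<close> is at least
  one.\<close>

lemma bexp_and_or_lower:
  assumes "finite T" "disjoint P" "{} \<notin> P" "\<Union>P \<subseteq> T" "B \<subseteq> T" "card B + card P \<le> k"
    "0 < \<zeta>" "\<zeta> \<le> q" "q \<le> 1 - \<zeta>" "\<And>A. A \<in> P \<Longrightarrow> \<not> A \<subseteq> B"
    "\<And>x. x \<in> cube T \<Longrightarrow> (\<forall>j\<in>B. \<not> x j) \<Longrightarrow> and_or P x = 1 \<Longrightarrow> 1 \<le> h x"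
    "\<And>x. x \<in> cube T \<Longrightarrow> 0 \<le> h x"
  shows "\<zeta> ^ k \<le> bexp T q h"
proof -
  have "\<forall>A\<in>P. \<exists>j. j \<in> A - B" using assms(10) by blast
  then obtain c where c: "\<And>A. A \<in> P \<Longrightarrow> c A \<in> A - B" by metis
  have fP: "finite P" using assms(1,4) by (meson finite_UnionD finite_subset)
  have cc: "card (c ` P) \<le> card P" using fP by (rule card_image_le)
  have "\<zeta> ^ k \<le> bexp T q (\<lambda>x. of_bool ((\<forall>j\<in>B. \<not> x j) \<and> (\<forall>j\<in>c ` P. x j)))"
  proof (rule bexp_subcube)
    show "c ` P \<subseteq> T" using c assms(4) by blast
    show "B \<inter> c ` P = {}" using c by blast
  qed (use assms cc in auto)
  also have "\<dots> \<le> bexp T q h"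
  proof (rule bexp_mono[OF assms(1)])
    fix x assume x: "x \<in> cube T"
    show "of_bool ((\<forall>j\<in>B. \<not> x j) \<and> (\<forall>j\<in>c ` P. x j)) \<le> h x"
    proof (cases "(\<forall>j\<in>B. \<not> x j) \<and> (\<forall>j\<in>c ` P. x j)")
      case True
      hence "and_or P x = 1" using c by (auto simp: and_or_def)
      thus ?thesis using assms(11)[OF x] True by auto
    qed (use assms(12)[OF x] in auto)
  qed
  finally show ?thesis .
qed

text \<open>If a small part of \<open>P\<close> is not a part of \<open>P'\<close>, then setting it (or a part of \<open>P'\<close> inside it)
  to zero and one element of every part of the other family to one separates the two functions.\<close>

lemma small_part_mem:
  assumes T: "finite T" and P: "disjoint P" "{} \<notin> P" "\<Union>P \<subseteq> T" "card P \<le> m"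
    and P': "disjoint P'" "{} \<notin> P'" "\<Union>P' \<subseteq> T" "card P' \<le> m"
    and z: "0 < \<zeta>" "\<zeta> \<le> q" "q \<le> 1 - \<zeta>"
    and close: "bexp T q (\<lambda>x. \<bar>and_or P x - and_or P' x\<bar>) < \<zeta> ^ (L + m)"
    and A: "A \<in> P" "card A \<le> L"
  shows "A \<in> P'"
proof (rule ccontr)
  assume nA: "A \<notin> P'"
  have AT: "A \<subseteq> T" using P(3) A by auto
  show False
  proof (cases "\<exists>B\<in>P'. B \<subseteq> A")
    case False
    have "\<zeta> ^ (L + m) \<le> bexp T q (\<lambda>x. \<bar>and_or P x - and_or P' x\<bar>)"
    proof (rule bexp_and_or_lower[OF T P'(1-3) AT])
      fix x assume "\<forall>j\<in>A. \<not> x j" "and_or P' x = 1"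
      moreover from this(1) have "and_or P x = 0" using A by (auto simp: and_or_def)
      ultimately show "1 \<le> \<bar>and_or P x - and_or P' x\<bar>" by simp
    qed (use False P' A z in auto)
    thus False using close by simp
  next
    case True
    then obtain B where B: "B \<in> P'" "B \<subset> A" using nA by auto
    hence BT: "B \<subseteq> T" using AT by auto
    have "card B \<le> card A" using B AT T by (meson card_mono finite_subset psubset_imp_subset)
    moreover have "\<not> C \<subseteq> B" if "C \<in> P" for C
    proof (cases "C = A")
      case False
      hence "C \<inter> A = {}" using P(1) A(1) that by (auto simp: pairwise_def disjnt_def)
      moreover have "C \<noteq> {}" using P(2) that by auto
      ultimately show ?thesis using B by blast
    qed (use B in auto)
    ultimately have "\<zeta> ^ (L + m) \<le> bexp T q (\<lambda>x. \<bar>and_or P x - and_or P' x\<bar>)"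
    proof (intro bexp_and_or_lower[OF T P(1-3) BT])
      fix x assume "\<forall>j\<in>B. \<not> x j" "and_or P x = 1"
      moreover from this(1) have "and_or P' x = 0" using B by (auto simp: and_or_def)
      ultimately show "1 \<le> \<bar>and_or P x - and_or P' x\<bar>" by simp
    qed (use P A z in auto)
    thus False using close by simp
  qed
qed

text \<open>Dropping the large parts changes the value only where a dropped part is all zero, and
  for a part \<open>A\<close> this has probability \<open>(1 - q) ^ card A\<close>.\<close>

lemma and_or_small_parts:
  assumes "finite T" "finite P" "\<Union>P \<subseteq> T" "card P \<le> m" "0 \<le> \<zeta>" "\<zeta> \<le> q" "q \<le> 1"
  shows "bexp T q (\<lambda>x. \<bar>and_or P x - and_or {A\<in>P. card A \<le> L} x\<bar>) \<le> m * (1 - \<zeta>) ^ L"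
proof -
  let ?R = "{A\<in>P. \<not> card A \<le> L}"
  have "bexp T q (\<lambda>x. \<bar>and_or P x - and_or {A\<in>P. card A \<le> L} x\<bar>)
    \<le> bexp T q (\<lambda>x. \<Sum>A\<in>?R. of_bool (\<forall>j\<in>A. \<not> x j))"
  proof (rule bexp_mono[OF assms(1)])
    fix x
    show "\<bar>and_or P x - and_or {A\<in>P. card A \<le> L} x\<bar> \<le> (\<Sum>A\<in>?R. of_bool (\<forall>j\<in>A. \<not> x j))"
    proof (cases "and_or P x = and_or {A\<in>P. card A \<le> L} x")
      case False
      hence "(\<forall>A\<in>P. \<exists>j\<in>A. x j) \<noteq> (\<forall>A\<in>{A\<in>P. card A \<le> L}. \<exists>j\<in>A. x j)"
        unfolding and_or_def by (rule contrapos_nn) (simp only:)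
      then obtain A where A: "A \<in> ?R" "\<forall>j\<in>A. \<not> x j" by auto
      have "\<bar>and_or P x - and_or {A\<in>P. card A \<le> L} x\<bar> \<le> 1" by (simp add: and_or_def)
      also have "1 = (of_bool (\<forall>j\<in>A. \<not> x j) :: real)" using A by simp
      also have "\<dots> \<le> (\<Sum>A\<in>?R. of_bool (\<forall>j\<in>A. \<not> x j))"
        by (rule member_le_sum) (use A assms in auto)
      finally show ?thesis .
    qed (simp add: sum_nonneg)
  qed
  also have "\<dots> = (\<Sum>A\<in>?R. (1 - q) ^ card A)"
    unfolding bexp_sum[OF assms(1)] using assms by (intro sum.cong refl bexp_all_zero) auto
  also have "\<dots> \<le> (\<Sum>A\<in>?R. (1 - \<zeta>) ^ L)"
  proof (rule sum_mono)
    fix A assume "A \<in> ?R"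
    have "(1 - q) ^ card A \<le> (1 - q) ^ L" using \<open>A \<in> ?R\<close> assms by (intro power_decreasing) auto
    also have "\<dots> \<le> (1 - \<zeta>) ^ L" using assms by (intro power_mono) auto
    finally show "(1 - q) ^ card A \<le> (1 - \<zeta>) ^ L" .
  qed
  also have "\<dots> = card ?R * (1 - \<zeta>) ^ L" by simp
  also have "\<dots> \<le> m * (1 - \<zeta>) ^ L"
  proof (rule mult_right_mono)
    have "card ?R \<le> card P" using assms by (intro card_mono) auto
    thus "real (card ?R) \<le> real m" using assms(4) by simp
  qed (use assms in auto)
  finally show ?thesis .
qed

text \<open>Averaging turns the exclusive or over a large part into a constant close to \<open>1/2\<close>.\<close>

lemma and_xor_small_parts:
  assumes T0: "finite T0" and P: "finite P" "disjoint P" "\<Union>P \<subseteq> T0" "card P \<le> m"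
    and z: "0 \<le> \<zeta>" "\<zeta> \<le> p" "p \<le> 1"
    and S: "S = {A\<in>P. card A \<le> L}" and T: "T = \<Union>S"
  shows "\<bar>2 ^ card P * bexp (T0 - T) (p/2) (\<lambda>b. and_xor P (glue T a b)) - 2 ^ card S * and_xor S a\<bar>
    \<le> 2 ^ card S * (m * (1 - \<zeta>) ^ L)"
proof -
  define R where "R = P - S"
  have SR: "P = S \<union> R" "S \<inter> R = {}" "finite S" "finite R" using P by (auto simp: R_def S)
  have RT: "A \<inter> T = {}" if "A \<in> R" for A
  proof -
    have "A \<inter> B = {}" if "B \<in> S" for B
    proof -
      have "A \<in> P" "B \<in> P" "A \<noteq> B" using \<open>A \<in> R\<close> that SR by auto
      thus ?thesis using P(2) by (simp add: pairwise_def disjnt_def)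
    qed
    thus ?thesis by (auto simp: T)
  qed
  hence RU: "\<Union>R \<subseteq> T0 - T" using P(3) SR by blast
  have "and_xor P (glue T a b) = and_xor S a * and_xor R b" for b
  proof -
    have "and_xor P (glue T a b) = and_xor S (glue T a b) * and_xor R (glue T a b)"
      unfolding SR(1) by (auto simp: and_xor_def)
    also have "and_xor S (glue T a b) = and_xor S a" by (rule and_xor_cong) (auto simp: glue_def T)
    also have "and_xor R (glue T a b) = and_xor R b" by (rule and_xor_cong) (use RT in \<open>auto simp: glue_def\<close>)
    finally show ?thesis .
  qed
  hence "bexp (T0 - T) (p/2) (\<lambda>b. and_xor P (glue T a b)) = and_xor S a * bexp (T0 - T) (p/2) (and_xor R)"
    by (simp add: bexp_cmult)
  \<comment> \<open>Bias \<open>p/2\<close> produces the base \<open>1 - p\<close>. The halves from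
    the large parts will cancel \<open>2 ^ card R\<close> in the normalisation, leaving factors
    close to one.\<close>
  also have "bexp (T0 - T) (p/2) (and_xor R) = (\<Prod>A\<in>R. (1 - (1 - 2 * (p/2)) ^ card A) / 2)"
    using T0 SR P RU z by (intro bexp_and_xor) (auto simp: pairwise_def)
  also have "\<dots> = (\<Prod>A\<in>R. 1 - (1 - p) ^ card A) / 2 ^ card R" by (simp add: prod_dividef)
  finally have e: "2 ^ card P * bexp (T0 - T) (p/2) (\<lambda>b. and_xor P (glue T a b))
      = 2 ^ card S * and_xor S a * (\<Prod>A\<in>R. 1 - (1 - p) ^ card A)"
    using SR by (simp add: card_Un_disjoint power_add)
  let ?Q = "\<Prod>A\<in>R. 1 - (1 - p) ^ card A"
  have pw: "(1 - p) ^ k \<le> 1" "0 \<le> (1 - p) ^ k" for k using z by (auto intro: power_le_one)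
  have Q1: "?Q \<le> 1" using pw by (intro prod_le_1) auto
  have "1 - ?Q \<le> (\<Sum>A\<in>R. (1 - p) ^ card A)" using pw SR by (intro one_minus_prod_le) auto
  also have "\<dots> \<le> (\<Sum>A\<in>R. (1 - \<zeta>) ^ L)"
  proof (rule sum_mono)
    fix A assume "A \<in> R"
    have "(1 - p) ^ card A \<le> (1 - p) ^ L" using \<open>A \<in> R\<close> z by (intro power_decreasing) (auto simp: R_def S)
    also have "\<dots> \<le> (1 - \<zeta>) ^ L" using z by (intro power_mono) auto
    finally show "(1 - p) ^ card A \<le> (1 - \<zeta>) ^ L" .
  qed
  also have "\<dots> = card R * (1 - \<zeta>) ^ L" by simp
  also have "\<dots> \<le> m * (1 - \<zeta>) ^ L"
  proof (rule mult_right_mono)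
    have "card R \<le> card P" using P by (intro card_mono) (auto simp: R_def)
    thus "real (card R) \<le> real m" using P(4) by simp
  qed (use z in auto)
  finally have Q2: "1 - ?Q \<le> m * (1 - \<zeta>) ^ L" .
  have "\<bar>2 ^ card S * and_xor S a * ?Q - 2 ^ card S * and_xor S a\<bar> = 2 ^ card S * (and_xor S a * (1 - ?Q))"
  proof -
    have "2 ^ card S * and_xor S a * ?Q - 2 ^ card S * and_xor S a = - (2 ^ card S * (and_xor S a * (1 - ?Q)))"
      by (simp add: algebra_simps)
    moreover have "0 \<le> 2 ^ card S * (and_xor S a * (1 - ?Q))"
      using Q1 by (intro mult_nonneg_nonneg) (auto simp: and_xor_def)
    ultimately show ?thesis by simp
  qed
  also have "\<dots> \<le> 2 ^ card S * (1 * (1 - ?Q))"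
    using Q1 by (intro mult_left_mono mult_right_mono) (auto simp: and_xor_def)
  also have "\<dots> \<le> 2 ^ card S * (m * (1 - \<zeta>) ^ L)" using Q2 by (intro mult_left_mono) auto
  finally show ?thesis unfolding e .
qed

text \<open>Outside \<open>T0\<close> a \<open>p/2\<close>-biased point is the conjunction of a
  \<open>p\<close>-biased \<open>w\<close> and a uniform \<open>z\<close>. The average thus becomes
  one over fixings \<open>w\<close> of slice functions that can be analysed one by one.\<close>

lemma restrict_avg_slices:
  assumes I: "finite I" and T: "T \<subseteq> T0" "T0 \<subseteq> I" and p: "0 \<le> p" "p \<le> 1"
  shows "restrict_avg I (p/2) T f a = bexp (I - T0) p (\<lambda>w. bexp (T0 - T) (p/2) (\<lambda>b.
    bexp (I - T0) (1/2) (\<lambda>z. f (glue T0 (glue T a b) (\<lambda>i. w i \<and> z i)))))"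
proof -
  have fin: "finite (I - T0)" "finite (I - T)" "finite (T0 - T)"
    using I finite_subset[OF T(2) I] by auto
  have sets: "T0 - T \<subseteq> I - T" "I - T - (T0 - T) = I - T0" using T by auto
  have "restrict_avg I (p/2) T f a = bexp (I - T) (p/2) (\<lambda>y. f (glue T a y))"
    by (simp add: restrict_avg_def bexp_def glue_def)
  also have "\<dots> = bexp (T0 - T) (p/2) (\<lambda>b. bexp (I - T0) (p/2) (\<lambda>y. f (glue T a (glue (T0 - T) b y))))"
    using bexp_glue[OF fin(2) sets(1), of "p/2" "\<lambda>y. f (glue T a y)"] unfolding sets(2) .
  also have "\<dots> = bexp (T0 - T) (p/2) (\<lambda>b. bexp (I - T0) (p/2) (\<lambda>y. f (glue T0 (glue T a b) y)))"
  proof -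
    have "glue T a (glue (T0 - T) b y) = glue T0 (glue T a b) y" for b y
      using T by (intro ext) (auto simp: glue_def)
    thus ?thesis by simp
  qed
  also have "\<dots> = bexp (T0 - T) (p/2) (\<lambda>b. bexp (I - T0) p (\<lambda>w. bexp (I - T0) (1/2)
      (\<lambda>z. f (glue T0 (glue T a b) (\<lambda>i. w i \<and> z i)))))"
    using p by (subst bexp_compose[OF fin(1)]) auto
  also have "\<dots> = bexp (I - T0) p (\<lambda>w. bexp (T0 - T) (p/2) (\<lambda>b. bexp (I - T0) (1/2)
      (\<lambda>z. f (glue T0 (glue T a b) (\<lambda>i. w i \<and> z i)))))"
    by (rule bexp_swap[OF fin(3,1)])
  finally show ?thesis .
qed

text \<open>Noise acts independently on the two blocks. For fixed \<open>w\<close> the equation for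
  \<open>f\<close> becomes an equation on the cube over \<open>T\<close> for \<open>f\<close>
  averaged over the outer noise.\<close>

lemma thin_glue:
  assumes I: "finite I" "T \<subseteq> I"
  shows "thin k I f (glue T a w) = thin k T (\<lambda>c. bexp (I - T) k (\<lambda>z. f (glue T c (\<lambda>i. w i \<and> z i)))) a"
proof -
  have "(\<lambda>i. glue T a w i \<and> glue T c z i) = glue T (\<lambda>i. a i \<and> c i) (\<lambda>i. w i \<and> z i)" for c z
    by (auto simp: glue_def)
  thus ?thesis unfolding thin_def by (simp add: bexp_glue[OF I, of k])
qed

subsection \<open>Assembling the approximate solution\<close>

text \<open>The thresholds have separate roles: \<open>\<beta>\<close> bounds the dependence of
  \<open>g\<close> on coordinates outside \<open>T0\<close>, \<open>\<eta>2\<close> is the error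
  tolerated in a slice, \<open>\<kappa>\<close> the pointwise error of the solution found there, and
  \<open>\<epsilon>2\<close> a disagreement with the reference slice under which the small parts
  coincide. Slices violating them are rare by Markov.\<close>

lemma junta_to_solution:
  fixes f g :: "(nat \<Rightarrow> bool) \<Rightarrow> real" and p lam \<zeta> \<epsilon> \<eta> \<eta>2 \<epsilon>2 \<beta> \<kappa> :: real and L m :: nat
  assumes I: "finite I" and z: "0 < \<zeta>" "\<zeta> \<le> p" "p \<le> 1 - \<zeta>" and lam: "\<zeta> \<le> lam" "lam \<le> 1"
    and f: "\<And>x. 0 \<le> f x" "\<And>x. f x \<le> 1" and g: "\<And>x. g x \<in> {0, 1}"
    and eta: "bexp I p (\<lambda>x. \<bar>thin (1/2) I f x - lam * g x\<bar>) \<le> \<eta>"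
    and T0: "T0 \<subseteq> I"
    and jun: "bexp T0 p (\<lambda>a. bexp (I - T0) p (\<lambda>w. bexp (I - T0) p
      (\<lambda>w'. \<bar>g (glue T0 a w) - g (glue T0 a w')\<bar>))) \<le> \<beta>"
    and pos: "0 < \<eta>" "0 < \<beta>" "0 < \<epsilon>" "0 < \<kappa>"
    and m: "2 / \<zeta> < 2 ^ m" and L: "m * (1 - \<zeta>) ^ L \<le> \<epsilon> / 8"
    and k: "\<kappa> < \<zeta>" "\<kappa> \<le> \<epsilon> / 8" and e2: "\<epsilon>2 < \<zeta> ^ (L + m)" "0 < \<epsilon>2"
    and h2: "2 * \<eta> \<le> \<eta>2" "3 ^ card T0 * (\<eta>2 / \<zeta> ^ card T0) \<le> \<kappa>"
    and b: "2 * \<beta> \<le> \<epsilon>2" "\<beta> \<le> \<epsilon> / 4" "6 * \<beta> / \<epsilon>2 \<le> \<epsilon> / 8" and h: "\<eta> \<le> \<epsilon> / 2" "3 * \<eta> / \<eta>2 \<le> \<epsilon> / 8"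
  obtains T P where "T \<subseteq> I" "card T \<le> m * L" "partition_on T P" "card P \<le> m"
    "(L1_close I (p/2) \<epsilon> f (\<lambda>_. 0) \<and> L1_close I p \<epsilon> g (\<lambda>_. 0)) \<or>
     (L1_close I p \<epsilon> g (and_or P) \<and>
      L1_close T (p/2) \<epsilon> (restrict_avg I (p/2) T f) (\<lambda>x. 2 ^ card P * lam * and_xor P x))"
proof -
  have p: "0 < p" "p < 1" and lam0: "0 < lam" and z1: "\<zeta> \<le> 1" using z lam by auto
  have L1: "L1_close J q e u v \<longleftrightarrow> bexp J q (\<lambda>x. \<bar>u x - v x\<bar>) \<le> e" for J q e u v
    by (simp add: L1_close_def L1_norm_def bexp_def)
  define W where "W = I - T0"
  define H where "H = thin (1/2) I f"
  have fin: "finite T0" "finite W" using I T0 finite_subset by (auto simp: W_def)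
  have split: "bexp I p u = bexp W p (\<lambda>w. bexp T0 p (\<lambda>a. u (glue T0 a w)))" for u
    unfolding bexp_glue[OF I T0] W_def[symmetric] by (rule bexp_swap[OF fin])
  define Y where "Y = (\<lambda>w. bexp T0 p (\<lambda>a. \<bar>H (glue T0 a w) - lam * g (glue T0 a w)\<bar>))"
  define Z where "Z = (\<lambda>w w'. bexp T0 p (\<lambda>a. \<bar>g (glue T0 a w) - g (glue T0 a w')\<bar>))"
  define X where "X = (\<lambda>w. bexp W p (Z w))"
  have Y0: "0 \<le> Y w" for w unfolding Y_def by (rule bexp_nonneg[OF fin(1)]) simp
  have Z0: "0 \<le> Z w w'" for w w' unfolding Z_def by (rule bexp_nonneg[OF fin(1)]) simp
  have X0: "0 \<le> X w" for w unfolding X_def by (rule bexp_nonneg[OF fin(2)]) (rule Z0)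
  have EY: "bexp W p Y \<le> \<eta>" using eta unfolding H_def[symmetric] split Y_def .
  have EX: "bexp W p X \<le> \<beta>"
  proof -
    have "bexp W p X = bexp W p (\<lambda>w. bexp T0 p (\<lambda>a. bexp W p (\<lambda>w'. \<bar>g (glue T0 a w) - g (glue T0 a w')\<bar>)))"
      unfolding X_def Z_def by (subst bexp_swap[OF fin]) simp
    also have "\<dots> = bexp T0 p (\<lambda>a. bexp W p (\<lambda>w. bexp W p (\<lambda>w'. \<bar>g (glue T0 a w) - g (glue T0 a w')\<bar>)))"
      by (rule bexp_swap[OF fin(2,1)])
    also have "\<dots> \<le> \<beta>" using jun by (simp add: W_def)
    finally show ?thesis .
  qed
  obtain w0 where w0: "w0 \<in> cube W" "X w0 \<le> 2 * \<beta>" "Y w0 \<le> \<eta>2"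
  proof -
    \<comment> \<open>Averaging the weighted sum yields one point at which both quantities are
      small.\<close>
    have "bexp W p (\<lambda>w. X w / \<beta> + Y w / \<eta>) = bexp W p X / \<beta> + bexp W p Y / \<eta>"
      by (simp add: bexp_add fin bexp_divide)
    also have "\<dots> \<le> \<beta> / \<beta> + \<eta> / \<eta>" using EX EY pos by (intro add_mono divide_right_mono) auto
    also have "\<dots> = 2" using pos by simp
    finally obtain w where w: "w \<in> cube W" "X w / \<beta> + Y w / \<eta> \<le> 2"
      using bexp_exists_le[OF fin(2)] by blast
    have "0 \<le> X w / \<beta>" "0 \<le> Y w / \<eta>" using X0 Y0 pos by auto
    hence "X w / \<beta> \<le> 2" "Y w / \<eta> \<le> 2" using w(2) by linarith+
    hence "X w \<le> 2 * \<beta>" "Y w \<le> 2 * \<eta>" using pos by (simp_all add: field_simps)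
    thus ?thesis using that w(1) h2(1) by force
  qed
  define \<phi> where "\<phi> = (\<lambda>w c. bexp W (1/2) (\<lambda>z. f (glue T0 c (\<lambda>i. w i \<and> z i))))"
  have phi01: "0 \<le> \<phi> w c" "\<phi> w c \<le> 1" for w c
    unfolding \<phi>_def using f by (auto intro: bexp_nonneg[OF fin(2)] bexp_le[OF fin(2)])
  define Sol where "Sol = (\<lambda>w P. disjoint P \<and> {} \<notin> P \<and> \<Union>P \<subseteq> T0 \<and> card P \<le> m \<and> 2 ^ card P * lam \<le> 2 \<and>
    (\<forall>a\<in>cube T0. g (glue T0 a w) = and_or P a) \<and>
    (\<forall>a\<in>cube T0. \<bar>\<phi> w a - 2 ^ card P * lam * and_xor P a\<bar> \<le> \<kappa>))"
  have slice: "(\<forall>a\<in>cube T0. g (glue T0 a w) = 0) \<or> (\<exists>P. Sol w P)" if w: "Y w \<le> \<eta>2" for w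
  proof (rule disjCI)
    assume "\<nexists>P. Sol w P"
    show "\<forall>a\<in>cube T0. g (glue T0 a w) = 0"
    proof (rule ccontr)
      assume "\<not> (\<forall>a\<in>cube T0. g (glue T0 a w) = 0)"
      then obtain a0 where a0: "a0 \<in> cube T0" "g (glue T0 a0 w) \<noteq> 0" by blast
      have close: "\<bar>thin (1/2) T0 (\<phi> w) a - lam * g (glue T0 a w)\<bar> \<le> \<eta>2 / \<zeta> ^ card T0"
        if a: "a \<in> cube T0" for a
      proof -
        have "\<zeta> ^ card T0 * \<bar>H (glue T0 a w) - lam * g (glue T0 a w)\<bar> \<le> Y w"
          unfolding Y_def by (rule bexp_point[OF fin(1) a]) (use z in auto)
        also note w
        finally have "\<bar>H (glue T0 a w) - lam * g (glue T0 a w)\<bar> \<le> \<eta>2 / \<zeta> ^ card T0"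
          using z by (simp add: field_simps)
        thus ?thesis unfolding H_def thin_glue[OF I T0] \<phi>_def W_def .
      qed
      have sm: "3 ^ card T0 * (\<eta>2 / \<zeta> ^ card T0) < lam" using h2(2) k lam by linarith
      obtain P where P: "disjoint P" "{} \<notin> P" "\<Union>P \<subseteq> T0"
        "\<And>a. a \<in> cube T0 \<Longrightarrow> g (glue T0 a w) = and_or P a"
        "\<And>a. a \<in> cube T0 \<Longrightarrow> \<bar>\<phi> w a - 2 ^ card P * lam * and_xor P a\<bar> \<le> 3 ^ card T0 * (\<eta>2 / \<zeta> ^ card T0)"
        using approx_solution_structure[where T = T0 and \<phi> = "\<phi> w" and \<gamma> = "\<lambda>a. g (glue T0 a w)",
              OF fin(1) phi01(1) g lam0 close sm a0] by metis
      have P5: "\<bar>\<phi> w a - 2 ^ card P * lam * and_xor P a\<bar> \<le> \<kappa>" if "a \<in> cube T0" for a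
        using P(5)[OF that] h2(2) by linarith
      \<comment> \<open>At this point \<open>2 ^ card P * lam\<close> is at most
        \<open>1 + \<kappa>\<close>, hence at most two; as \<open>lam\<close> is at least
        \<open>\<zeta>\<close>, this bounds \<open>card P\<close>.\<close>
      obtain a where a: "a \<in> cube T0" "and_xor P a = 1"
        using and_xor_transversal[OF P(1-3)] by blast
      have le2: "2 ^ card P * lam \<le> 2"
        using P5[OF a(1)] a(2) phi01(2)[of w a] k(1) z1 by (simp add: abs_if split: if_splits)
      have "card P \<le> m"
      proof (rule ccontr)
        assume "\<not> card P \<le> m"
        hence "(2::real) ^ m \<le> 2 ^ card P" by (intro power_increasing) auto
        hence "2 / \<zeta> < 2 ^ card P" using m by linarith
        hence "2 < 2 ^ card P * \<zeta>" using z by (simp add: field_simps)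
        also have "\<dots> \<le> 2 ^ card P * lam" using lam by simp
        finally show False using le2 by simp
      qed
      hence "Sol w P" unfolding Sol_def using P P5 le2 by blast
      thus False using \<open>\<nexists>P. Sol w P\<close> by blast
    qed
  qed
  have Xw0: "bexp W p (\<lambda>w. bexp T0 p (\<lambda>a. \<bar>g (glue T0 a w0) - g (glue T0 a w)\<bar>)) \<le> 2 * \<beta>"
    using w0(2) unfolding X_def Z_def .
  consider "\<forall>a\<in>cube T0. g (glue T0 a w0) = 0" | P where "Sol w0 P"
    using slice[OF w0(3)] by blast
  thus ?thesis
  proof cases
    case 1
    \<comment> \<open>If the reference slice of \<open>g\<close> vanishes, \<open>g\<close> is small
      in mean; so is \<open>f\<close>, because its \<open>p/2\<close>-biased mean is the
      \<open>p\<close>-biased mean of \<open>H\<close>.\<close>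
    have "bexp I p (\<lambda>x. \<bar>g x\<bar>) = bexp W p (\<lambda>w. bexp T0 p (\<lambda>a. \<bar>g (glue T0 a w0) - g (glue T0 a w)\<bar>))"
      unfolding split by (intro bexp_cong fin) (use 1 in simp)
    hence Eg: "bexp I p (\<lambda>x. \<bar>g x\<bar>) \<le> 2 * \<beta>" using Xw0 by simp
    have "bexp I (p/2) (\<lambda>x. \<bar>f x\<bar>) = bexp I (p * (1/2)) f" using f by simp
    also have "\<dots> = bexp I p H"
      unfolding H_def thin_def using p by (intro bexp_compose[symmetric] I) auto
    also have "\<dots> \<le> bexp I p (\<lambda>x. \<bar>H x - lam * g x\<bar> + \<bar>g x\<bar>)"
    proof (rule bexp_mono[OF I])
      fix x
      have "lam * g x \<le> \<bar>g x\<bar>" using g[of x] lam by auto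
      thus "H x \<le> \<bar>H x - lam * g x\<bar> + \<bar>g x\<bar>" by linarith
    qed
    also have "\<dots> \<le> \<eta> + 2 * \<beta>" using eta Eg by (simp add: bexp_add I H_def)
    also have "\<dots> \<le> \<epsilon>" using h b by linarith
    finally have "L1_close I (p/2) \<epsilon> f (\<lambda>_. 0)" by (simp add: L1)
    moreover have "L1_close I p \<epsilon> g (\<lambda>_. 0)" using Eg b pos by (simp add: L1)
    ultimately show ?thesis using that[of "{}" "{}"] by (simp add: partition_on_def)
  next
    case (2 P)
    hence P: "disjoint P" "{} \<notin> P" "\<Union>P \<subseteq> T0" "card P \<le> m" "2 ^ card P * lam \<le> 2"
      "\<And>a. a \<in> cube T0 \<Longrightarrow> g (glue T0 a w0) = and_or P a" by (auto simp: Sol_def)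
    have fP: "finite P" using P(3) fin(1) by (meson finite_UnionD finite_subset)
    \<comment> \<open>The parts come from the reference slice; every other good slice turns out to
      have the same small parts.\<close>
    define S where "S = {A\<in>P. card A \<le> L}"
    define T where "T = \<Union>S"
    have SP: "S \<subseteq> P" by (auto simp: S_def)
    have fS: "finite S" using SP fP finite_subset by blast
    have cS: "card S \<le> card P" using SP fP by (rule card_mono[rotated])
    have TT0: "T \<subseteq> T0" using P(3) SP by (auto simp: T_def)
    have fT: "finite T" using TT0 fin(1) finite_subset by blast
    have fTT: "finite (T0 - T)" using fin(1) by simp
    have cT: "card T \<le> m * L"
    proof -
      have "card T \<le> (\<Sum>A\<in>S. card A)" unfolding T_def by (rule card_Union_le_sum_card)
      also have "\<dots> \<le> (\<Sum>A\<in>S. L)" by (rule sum_mono) (simp add: S_def)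
      also have "\<dots> = card S * L" by simp
      also have "\<dots> \<le> m * L" using cS P(4) by (intro mult_right_mono) auto
      finally show ?thesis .
    qed
    have part: "partition_on T S"
      unfolding partition_on_def using P(1,2) SP by (auto simp: T_def pairwise_def)
    have S2: "2 ^ card S * lam \<le> 2"
    proof -
      have "2 ^ card S * lam \<le> 2 ^ card P * lam"
        using cS lam0 by (intro mult_right_mono power_increasing) auto
      thus ?thesis using P(5) by simp
    qed
    have "bexp I p (\<lambda>x. \<bar>g x - and_or S x\<bar>)
      \<le> bexp W p (\<lambda>w. bexp T0 p (\<lambda>a. \<bar>g (glue T0 a w0) - g (glue T0 a w)\<bar> + \<bar>and_or P a - and_or S a\<bar>))"
      unfolding split
    proof (intro bexp_mono fin)
      fix w a assume a: "a \<in> cube T0"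
      have "and_or S (glue T0 a w) = and_or S a"
        unfolding and_or_def glue_def using TT0
        by (intro arg_cong[of _ _ of_bool] ball_cong bex_cong refl) (auto simp: T_def)
      thus "\<bar>g (glue T0 a w) - and_or S (glue T0 a w)\<bar>
        \<le> \<bar>g (glue T0 a w0) - g (glue T0 a w)\<bar> + \<bar>and_or P a - and_or S a\<bar>"
        using P(6)[OF a] by linarith
    qed
    also have "\<dots> \<le> 2 * \<beta> + m * (1 - \<zeta>) ^ L"
      using Xw0 and_or_small_parts[OF fin(1) fP P(3,4), of \<zeta> p L] z p
      by (simp add: bexp_add fin S_def)
    also have "\<dots> \<le> \<epsilon>" using b L pos by linarith
    finally have i: "L1_close I p \<epsilon> g (and_or S)" by (simp add: L1)
    define \<Delta> where "\<Delta> = (\<lambda>w. bexp T (p/2) (\<lambda>a. \<bar>bexp (T0 - T) (p/2) (\<lambda>b. \<phi> w (glue T a b))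
      - 2 ^ card S * lam * and_xor S a\<bar>))"
    have good: "\<Delta> w \<le> \<kappa> + 2 * (m * (1 - \<zeta>) ^ L)" if w: "Y w \<le> \<eta>2" "Z w0 w \<le> \<epsilon>2" for w
    proof -
      \<comment> \<open>A vanishing slice would differ from the reference slice wherever
        \<open>and_or P\<close> is one, a set of measure above \<open>\<epsilon>2\<close>.\<close>
      have ne: "\<not> (\<forall>a\<in>cube T0. g (glue T0 a w) = 0)"
      proof
        assume zero: "\<forall>a\<in>cube T0. g (glue T0 a w) = 0"
        have "\<zeta> ^ (L + m) \<le> bexp T0 p (\<lambda>a. \<bar>g (glue T0 a w0) - g (glue T0 a w)\<bar>)"
        proof (rule bexp_and_or_lower[OF fin(1) P(1-3), of "{}"])
          fix a assume "a \<in> cube T0" "and_or P a = 1"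
          thus "1 \<le> \<bar>g (glue T0 a w0) - g (glue T0 a w)\<bar>" using zero P(6) by simp
        qed (use P z in auto)
        thus False using w(2) e2 unfolding Z_def by linarith
      qed
      then obtain P' where "Sol w P'" using slice[OF w(1)] by blast
      hence P': "disjoint P'" "{} \<notin> P'" "\<Union>P' \<subseteq> T0" "card P' \<le> m"
        "\<And>a. a \<in> cube T0 \<Longrightarrow> g (glue T0 a w) = and_or P' a"
        "\<And>a. a \<in> cube T0 \<Longrightarrow> \<bar>\<phi> w a - 2 ^ card P' * lam * and_xor P' a\<bar> \<le> \<kappa>"
        by (auto simp: Sol_def)
      have fP': "finite P'" using P'(3) fin(1) by (meson finite_UnionD finite_subset)
      have "bexp T0 p (\<lambda>a. \<bar>and_or P a - and_or P' a\<bar>) = Z w0 w"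
        unfolding Z_def by (rule bexp_cong[OF fin(1)]) (simp add: P(6) P'(5))
      hence c1: "bexp T0 p (\<lambda>a. \<bar>and_or P a - and_or P' a\<bar>) < \<zeta> ^ (L + m)" using w(2) e2 by simp
      hence c2: "bexp T0 p (\<lambda>a. \<bar>and_or P' a - and_or P a\<bar>) < \<zeta> ^ (L + m)"
        by (simp add: abs_minus_commute)
      have S': "S = {A\<in>P'. card A \<le> L}"
        using small_part_mem[OF fin(1) P(1-4) P'(1-4) z c1]
          small_part_mem[OF fin(1) P'(1-4) P(1-4) z c2] unfolding S_def by blast
      have "\<Delta> w \<le> bexp T (p/2) (\<lambda>a. \<kappa> + 2 * (m * (1 - \<zeta>) ^ L))"
        unfolding \<Delta>_def
      proof (rule bexp_mono[OF fT])
        fix a assume a: "a \<in> cube T"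
        let ?E = "bexp (T0 - T) (p/2)"
        have "\<bar>?E (\<lambda>b. \<phi> w (glue T a b)) - lam * (2 ^ card P' * ?E (\<lambda>b. and_xor P' (glue T a b)))\<bar>
          = \<bar>?E (\<lambda>b. \<phi> w (glue T a b) - 2 ^ card P' * lam * and_xor P' (glue T a b))\<bar>"
          by (simp only: bexp_diff[OF fTT] bexp_cmult) (simp add: mult_ac)
        also have "\<dots> \<le> ?E (\<lambda>b. \<bar>\<phi> w (glue T a b) - 2 ^ card P' * lam * and_xor P' (glue T a b)\<bar>)"
          by (rule bexp_abs[OF fTT])
        also have "\<dots> \<le> \<kappa>"
          by (rule bexp_le[OF fTT]) (use P'(6) glue_cube[OF TT0 a] in auto)
        finally have d1: "\<bar>?E (\<lambda>b. \<phi> w (glue T a b)) - lam * (2 ^ card P' * ?E (\<lambda>b. and_xor P' (glue T a b)))\<bar> \<le> \<kappa>" .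
        have "\<bar>2 ^ card P' * ?E (\<lambda>b. and_xor P' (glue T a b)) - 2 ^ card S * and_xor S a\<bar>
          \<le> 2 ^ card S * (m * (1 - \<zeta>) ^ L)"
          by (rule and_xor_small_parts[OF fin(1) fP' P'(1,3,4) _ _ _ S' T_def]) (use z p in auto)
        hence "lam * \<bar>2 ^ card P' * ?E (\<lambda>b. and_xor P' (glue T a b)) - 2 ^ card S * and_xor S a\<bar>
          \<le> lam * (2 ^ card S * (m * (1 - \<zeta>) ^ L))"
          using lam0 by (intro mult_left_mono) auto
        also have "\<dots> = (2 ^ card S * lam) * (m * (1 - \<zeta>) ^ L)" by simp
        also have "\<dots> \<le> 2 * (m * (1 - \<zeta>) ^ L)" using S2 z1 by (intro mult_right_mono) auto
        also have "lam * \<bar>2 ^ card P' * ?E (\<lambda>b. and_xor P' (glue T a b)) - 2 ^ card S * and_xor S a\<bar>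
          = \<bar>lam * (2 ^ card P' * ?E (\<lambda>b. and_xor P' (glue T a b))) - 2 ^ card S * lam * and_xor S a\<bar>"
        proof -
          have "lam * (2 ^ card P' * ?E (\<lambda>b. and_xor P' (glue T a b))) - 2 ^ card S * lam * and_xor S a
            = lam * (2 ^ card P' * ?E (\<lambda>b. and_xor P' (glue T a b)) - 2 ^ card S * and_xor S a)"
            by (simp add: right_diff_distrib)
          thus ?thesis using lam0 by (simp add: abs_mult)
        qed
        finally show "\<bar>?E (\<lambda>b. \<phi> w (glue T a b)) - 2 ^ card S * lam * and_xor S a\<bar> \<le> \<kappa> + 2 * (m * (1 - \<zeta>) ^ L)"
          using d1 by linarith
      qed
      thus ?thesis by simp
    qed
    \<comment> \<open>The averaged slice is at most one and the target at most two.\<close>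
    have triv: "\<Delta> w \<le> 3" for w
      unfolding \<Delta>_def
    proof (rule bexp_le[OF fT])
      fix a
      have "0 \<le> bexp (T0 - T) (p/2) (\<lambda>b. \<phi> w (glue T a b))" by (rule bexp_nonneg[OF fTT]) (rule phi01)
      moreover have "bexp (T0 - T) (p/2) (\<lambda>b. \<phi> w (glue T a b)) \<le> 1" by (rule bexp_le[OF fTT]) (rule phi01)
      moreover have "0 \<le> 2 ^ card S * lam * and_xor S a" "2 ^ card S * lam * and_xor S a \<le> 2"
        using S2 lam0 by (auto simp: and_xor_def)
      ultimately show "\<bar>bexp (T0 - T) (p/2) (\<lambda>b. \<phi> w (glue T a b)) - 2 ^ card S * lam * and_xor S a\<bar> \<le> 3"
        by linarith
    qed
    have "bexp T (p/2) (\<lambda>a. \<bar>restrict_avg I (p/2) T f a - 2 ^ card S * lam * and_xor S a\<bar>)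
      \<le> bexp T (p/2) (\<lambda>a. bexp W p (\<lambda>w. \<bar>bexp (T0 - T) (p/2) (\<lambda>b. \<phi> w (glue T a b))
      - 2 ^ card S * lam * and_xor S a\<bar>))"
    proof (rule bexp_mono[OF fT])
      fix a
      have "restrict_avg I (p/2) T f a = bexp W p (\<lambda>w. bexp (T0 - T) (p/2) (\<lambda>b. \<phi> w (glue T a b)))"
        using restrict_avg_slices[OF I TT0 T0, of p f a] p by (simp add: \<phi>_def W_def)
      hence "restrict_avg I (p/2) T f a - 2 ^ card S * lam * and_xor S a
        = bexp W p (\<lambda>w. bexp (T0 - T) (p/2) (\<lambda>b. \<phi> w (glue T a b)) - 2 ^ card S * lam * and_xor S a)"
        by (simp add: bexp_diff fin)
      thus "\<bar>restrict_avg I (p/2) T f a - 2 ^ card S * lam * and_xor S a\<bar>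
        \<le> bexp W p (\<lambda>w. \<bar>bexp (T0 - T) (p/2) (\<lambda>b. \<phi> w (glue T a b)) - 2 ^ card S * lam * and_xor S a\<bar>)"
        using bexp_abs[OF fin(2)] by simp
    qed
    also have "\<dots> = bexp W p \<Delta>"
      unfolding \<Delta>_def by (rule bexp_swap[OF fT fin(2)])
    also have "\<dots> \<le> bexp W p (\<lambda>w. (\<kappa> + 2 * (m * (1 - \<zeta>) ^ L))
        + (3 * of_bool (Y w > \<eta>2) + 3 * of_bool (Z w0 w > \<epsilon>2)))"
    proof (rule bexp_mono[OF fin(2)])
      fix w
      have nn: "0 \<le> \<kappa> + 2 * (m * (1 - \<zeta>) ^ L)" using pos z1 by simp
      consider "Y w \<le> \<eta>2" "Z w0 w \<le> \<epsilon>2" | "Y w > \<eta>2" | "Z w0 w > \<epsilon>2" by linarith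
      thus "\<Delta> w \<le> (\<kappa> + 2 * (m * (1 - \<zeta>) ^ L)) + (3 * of_bool (Y w > \<eta>2) + 3 * of_bool (Z w0 w > \<epsilon>2))"
        using good[of w] triv[of w] nn by cases auto
    qed
    also have "\<dots> = (\<kappa> + 2 * (m * (1 - \<zeta>) ^ L))
        + (3 * bexp W p (\<lambda>w. of_bool (Y w > \<eta>2)) + 3 * bexp W p (\<lambda>w. of_bool (Z w0 w > \<epsilon>2)))"
      by (simp add: bexp_add fin bexp_cmult)
    also have "\<dots> \<le> (\<epsilon> / 8 + 2 * (\<epsilon> / 8)) + (3 * (\<eta> / \<eta>2) + 3 * (2 * \<beta> / \<epsilon>2))"
    proof -
      have h20: "0 < \<eta>2" using h2 pos by linarith
      have "bexp W p (\<lambda>w. of_bool (Y w > \<eta>2)) \<le> bexp W p Y / \<eta>2"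
        by (rule bexp_markov[OF fin(2) h20]) (rule Y0)
      also have "\<dots> \<le> \<eta> / \<eta>2" using EY h20 by (intro divide_right_mono) auto
      finally have A: "bexp W p (\<lambda>w. of_bool (Y w > \<eta>2)) \<le> \<eta> / \<eta>2" .
      have "bexp W p (\<lambda>w. of_bool (Z w0 w > \<epsilon>2)) \<le> bexp W p (Z w0) / \<epsilon>2"
        by (rule bexp_markov[OF fin(2) e2(2)]) (rule Z0)
      also have "\<dots> \<le> 2 * \<beta> / \<epsilon>2" using w0(2) e2 unfolding X_def by (intro divide_right_mono) auto
      finally have B: "bexp W p (\<lambda>w. of_bool (Z w0 w > \<epsilon>2)) \<le> 2 * \<beta> / \<epsilon>2" .
      show ?thesis using A B k(2) L by linarith
    qed
    also have "\<dots> \<le> \<epsilon>" using b(3) h(2) pos by simp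
    finally have ii: "L1_close T (p/2) \<epsilon> (restrict_avg I (p/2) T f) (\<lambda>x. 2 ^ card S * lam * and_xor S x)"
      by (simp add: L1)
    have "T \<subseteq> I" using TT0 T0 by simp
    moreover have "card S \<le> m" using cS P(4) by simp
    ultimately show ?thesis using that cT part i ii by blast
  qed
qed

theorem theorem2p6:
  "\<forall>\<zeta>::real. \<zeta> > 0 \<longrightarrow> (\<exists>m::nat. \<forall>\<epsilon>::real. \<epsilon> > 0 \<longrightarrow> (\<exists>(\<eta>::real) (J::nat). \<eta> > 0 \<and>
     (\<forall>(p::real) (lam::real) (n::nat) (f :: (nat \<Rightarrow> bool) \<Rightarrow> real) (g :: (nat \<Rightarrow> bool) \<Rightarrow> real).
        p \<in> {\<zeta>..1 - \<zeta>} \<longrightarrow> lam \<in> {\<zeta>..1} \<longrightarrow>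
        f \<in> cube {..<n} \<rightarrow> {0..1} \<longrightarrow> g \<in> cube {..<n} \<rightarrow> {0, 1} \<longrightarrow>
        L1_norm {..<n} p (\<lambda>x. T_half {..<n} f x - lam * g x) \<le> \<eta> \<longrightarrow>
        (\<exists>(T :: nat set) (P :: nat set set).
           T \<subseteq> {..<n} \<and> card T \<le> J \<and> partition_on T P \<and> card P \<le> m \<and>
           ((L1_close {..<n} (p/2) \<epsilon> f (\<lambda>_. 0) \<and> L1_close {..<n} p \<epsilon> g (\<lambda>_. 0)) \<or>
            (L1_close {..<n} p \<epsilon> g (and_or P) \<and>
             L1_close T (p/2) \<epsilon> (restrict_avg {..<n} (p/2) T f)
               (\<lambda>x. 2 ^ card P * lam * and_xor P x)))))))"
proof -
  let "\<forall>\<zeta>::real. \<zeta> > 0 \<longrightarrow> (\<exists>m::nat. \<forall>\<epsilon>::real. \<epsilon> > 0 \<longrightarrow>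
    (\<exists>(\<eta>::real) (J::nat). ?Q \<zeta> m \<epsilon> \<eta> J))" = ?thesis
  show ?thesis
  proof (intro allI impI)
    fix \<zeta> :: real assume z0: "\<zeta> > 0"
    obtain m :: nat where m: "2 / \<zeta> < 2 ^ m"
      using real_arch_pow[of 2 "2 / \<zeta>"] by auto
    show "\<exists>m. \<forall>\<epsilon>. \<epsilon> > 0 \<longrightarrow> (\<exists>\<eta> J. ?Q \<zeta> m \<epsilon> \<eta> J)"
    proof (intro exI[of _ m] allI impI)
      fix \<epsilon> :: real assume e0: "\<epsilon> > 0"
      show "\<exists>\<eta> J. ?Q \<zeta> m \<epsilon> \<eta> J"
      proof (cases "\<zeta> < 1")
        case False
        \<comment> \<open>For \<open>\<zeta> \<ge> 1\<close> the range of \<open>p\<close> is empty,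
          so arbitrary values serve.\<close>
        show ?thesis by (intro exI[of _ 1] exI[of _ 0]) (use z0 False in auto)
      next
        case z1: True
        obtain L :: nat where L: "m * (1 - \<zeta>) ^ L \<le> \<epsilon> / 8"
        proof -
          obtain L where "(1 - \<zeta>) ^ L < \<epsilon> / 8 / (m + 1)"
            using real_arch_pow_inv[of "\<epsilon> / 8 / (m + 1)" "1 - \<zeta>"] z0 e0 by auto
          hence "(m + 1) * (1 - \<zeta>) ^ L \<le> \<epsilon> / 8" by (simp add: field_simps)
          moreover have "m * (1 - \<zeta>) ^ L \<le> (m + 1) * (1 - \<zeta>) ^ L" using z1 by (intro mult_right_mono) auto
          ultimately show ?thesis by (intro that) (rule order_trans)
        qed
        define \<epsilon>2 where "\<epsilon>2 = \<zeta> ^ (L + m) / 2"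
        have e2: "0 < \<epsilon>2" "\<epsilon>2 < \<zeta> ^ (L + m)" using z0 by (auto simp: \<epsilon>2_def)
        define \<beta> where "\<beta> = min (min (\<epsilon> / 4) (\<epsilon>2 / 2)) (\<epsilon> * \<epsilon>2 / 48)"
        have b: "0 < \<beta>" "\<beta> \<le> \<epsilon> / 4" "\<beta> \<le> \<epsilon>2 / 2" "\<beta> \<le> \<epsilon> * \<epsilon>2 / 48" using e0 e2 by (auto simp: \<beta>_def)
        define \<kappa> where "\<kappa> = min (\<zeta> / 2) (\<epsilon> / 8)"
        have k: "0 < \<kappa>" "\<kappa> < \<zeta>" "\<kappa> \<le> \<epsilon> / 8" using z0 e0 by (auto simp: \<kappa>_def)
        \<comment> \<open>Solves
          \<open>1152 / \<zeta> ^ 4 * \<tau> powr (\<zeta> / 6) = \<beta> / 2\<close>: the part of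
          the junta error that does not shrink with \<open>\<eta>\<close> uses half the
          budget.\<close>
        define \<tau> where "\<tau> = (\<beta> * \<zeta> ^ 4 / 2304) powr (6 / \<zeta>)"
        have tau: "0 < \<tau>" using b z0 by (simp add: \<tau>_def)
        have tau_pow: "1152 / \<zeta> ^ 4 * \<tau> powr (\<zeta> / 6) = \<beta> / 2"
        proof -
          have "\<tau> powr (\<zeta> / 6) = \<beta> * \<zeta> ^ 4 / 2304"
            unfolding \<tau>_def powr_powr using z0 b by simp
          thus ?thesis using z0 by (simp add: field_simps)
        qed
        define J0 where "J0 = nat \<lceil>3 / (\<zeta> * \<tau>)\<rceil>"
        \<comment> \<open>\<open>J0\<close> bounds \<open>card T0\<close> before
          \<open>\<eta>\<close> is chosen. Each coordinate costs a factor \<open>\<zeta>\<close> for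
          pointwise bounds and \<open>3\<close> for Moebius inversion.\<close>
        define \<eta>2 where "\<eta>2 = \<kappa> * (\<zeta> / 3) ^ J0"
        have h20: "0 < \<eta>2" using k z0 by (simp add: \<eta>2_def)
        \<comment> \<open>The four bounds serve, in order, the choice of the reference slice, the
          measure of slices with large error, the case of vanishing \<open>g\<close>, and the other
          half of the junta error.\<close>
        define \<eta> where "\<eta> = min (min (\<eta>2 / 2) (\<epsilon> * \<eta>2 / 24)) (min (\<epsilon> / 2) (\<beta> * \<zeta> ^ 3 / 240))"
        have eta: "0 < \<eta>" "\<eta> \<le> \<eta>2 / 2" "\<eta> \<le> \<epsilon> * \<eta>2 / 24" "\<eta> \<le> \<epsilon> / 2" "\<eta> \<le> \<beta> * \<zeta> ^ 3 / 240"
          using h20 e0 b z0 by (auto simp: \<eta>_def)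
        show ?thesis
        proof (intro exI[of _ \<eta>] exI[of _ "m * L"] conjI allI impI eta(1))
          fix p lam :: real and n :: nat and f g :: "(nat \<Rightarrow> bool) \<Rightarrow> real"
          let ?I = "{..<n}"
          assume p: "p \<in> {\<zeta>..1 - \<zeta>}" and lam: "lam \<in> {\<zeta>..1}"
            and f: "f \<in> cube ?I \<rightarrow> {0..1}" and g: "g \<in> cube ?I \<rightarrow> {0, 1}"
            and close: "L1_norm ?I p (\<lambda>x. T_half ?I f x - lam * g x) \<le> \<eta>"
          \<comment> \<open>The hypotheses constrain \<open>f\<close> and \<open>g\<close> on the
            cube only, whereas the lemmas ask for bounds at all points; extension by zero bridges
            this.\<close>
          define f' where "f' = (\<lambda>x. if x \<in> cube ?I then f x else 0)"
          define g' where "g' = (\<lambda>x. if x \<in> cube ?I then g x else 0)"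
          have f': "0 \<le> f' x" "f' x \<le> 1" for x using f by (auto simp: f'_def)
          have g': "g' x \<in> {0, 1}" for x using g by (auto simp: g'_def)
          have fI: "finite ?I" by simp
          have "thin (1/2) ?I f' x = T_half ?I f x" if "x \<in> cube ?I" for x
            unfolding thin_def T_half_def bexp_def[symmetric]
            by (rule bexp_cong[OF fI]) (use that in \<open>auto simp: f'_def cube_iff\<close>)
          hence "bexp ?I p (\<lambda>x. \<bar>thin (1/2) ?I f' x - lam * g' x\<bar>) = L1_norm ?I p (\<lambda>x. T_half ?I f x - lam * g x)"
            unfolding L1_norm_def bexp_def[symmetric] by (intro bexp_cong fI) (simp add: g'_def)
          hence close': "bexp ?I p (\<lambda>x. \<bar>thin (1/2) ?I f' x - lam * g' x\<bar>) \<le> \<eta>" using close by simp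
          have zp: "\<zeta> \<le> p" "p \<le> 1 - \<zeta>" "\<zeta> \<le> lam" "lam \<le> 1" using p lam by auto
          obtain T0 where T0: "T0 \<subseteq> ?I" "real (card T0) \<le> 3 / (\<zeta> * \<tau>)"
            "bexp T0 p (\<lambda>a. bexp (?I - T0) p (\<lambda>w. bexp (?I - T0) p (\<lambda>w'. \<bar>g' (glue T0 a w) - g' (glue T0 a w')\<bar>)))
              \<le> 120 * \<eta> / \<zeta> ^ 3 + 1152 / \<zeta> ^ 4 * \<tau> powr (\<zeta> / 6)"
            by (rule junta_approximation[OF fI z0 zp f' g' close' tau])
          have "120 * \<eta> / \<zeta> ^ 3 \<le> \<beta> / 2" using eta(5) z0 by (simp add: field_simps)
          hence jun: "bexp T0 p (\<lambda>a. bexp (?I - T0) p (\<lambda>w. bexp (?I - T0) p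
            (\<lambda>w'. \<bar>g' (glue T0 a w) - g' (glue T0 a w')\<bar>))) \<le> \<beta>"
            using T0(3) tau_pow by linarith
          have "card T0 \<le> J0" using T0(2) unfolding J0_def by linarith
          have kap: "3 ^ card T0 * (\<eta>2 / \<zeta> ^ card T0) \<le> \<kappa>"
          proof -
            have "\<eta>2 \<le> \<kappa> * (\<zeta> / 3) ^ card T0"
              unfolding \<eta>2_def using k z0 z1 \<open>card T0 \<le> J0\<close> by (intro mult_left_mono power_decreasing) auto
            hence "3 ^ card T0 * (\<eta>2 / \<zeta> ^ card T0) \<le> 3 ^ card T0 * (\<kappa> * (\<zeta> / 3) ^ card T0 / \<zeta> ^ card T0)"
              using z0 by (intro mult_left_mono divide_right_mono) auto
            also have "\<dots> = \<kappa>" using z0 by (simp add: power_divide)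
            finally show ?thesis .
          qed
          have b6: "6 * \<beta> / \<epsilon>2 \<le> \<epsilon> / 8" using b(4) e2 by (simp add: field_simps)
          have h3: "3 * \<eta> / \<eta>2 \<le> \<epsilon> / 8" using eta(3) h20 by (simp add: field_simps)
          have d2: "2 * \<eta> \<le> \<eta>2" "2 * \<beta> \<le> \<epsilon>2" using eta(2) b(3) by auto
          obtain T P where TP: "T \<subseteq> ?I" "card T \<le> m * L" "partition_on T P" "card P \<le> m"
            "(L1_close ?I (p/2) \<epsilon> f' (\<lambda>_. 0) \<and> L1_close ?I p \<epsilon> g' (\<lambda>_. 0)) \<or>
             (L1_close ?I p \<epsilon> g' (and_or P) \<and>
              L1_close T (p/2) \<epsilon> (restrict_avg ?I (p/2) T f') (\<lambda>x. 2 ^ card P * lam * and_xor P x))"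
            by (rule junta_to_solution[OF fI z0 zp f' g' close' T0(1) jun eta(1) b(1) e0 k(1) m L k(2,3)
              e2(2,1) d2(1) kap d2(2) b(2) b6 eta(4) h3])
          have cong: "L1_close J q \<epsilon> u v = L1_close J q \<epsilon> u' v"
            if "finite J" "\<And>x. x \<in> cube J \<Longrightarrow> u x = u' x" for J q u u' v
            unfolding L1_close_def L1_norm_def bexp_def[symmetric]
            using bexp_cong[OF that(1), of "\<lambda>x. \<bar>u x - v x\<bar>" "\<lambda>x. \<bar>u' x - v x\<bar>" q] that(2) by simp
          have f1: "L1_close ?I q \<epsilon> f' v = L1_close ?I q \<epsilon> f v" for q v
            by (rule cong) (auto simp: f'_def)
          have g1: "L1_close ?I q \<epsilon> g' v = L1_close ?I q \<epsilon> g v" for q v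
            by (rule cong) (auto simp: g'_def)
          have r1: "L1_close T q \<epsilon> (restrict_avg ?I (p/2) T f') v = L1_close T q \<epsilon> (restrict_avg ?I (p/2) T f) v" for q v
          proof (rule cong)
            show "finite T" using TP(1) finite_subset by blast
            fix x assume x: "x \<in> cube T"
            show "restrict_avg ?I (p/2) T f' x = restrict_avg ?I (p/2) T f x"
              unfolding restrict_avg_def bexp_def[symmetric]
            proof (rule bexp_cong)
              fix y assume y: "y \<in> cube (?I - T)"
              have "(\<lambda>i. if i \<in> T then x i else y i) \<in> cube ?I"
                using glue_cube[OF TP(1) x y] by (simp add: glue_def)
              thus "f' (\<lambda>i. if i \<in> T then x i else y i) = f (\<lambda>i. if i \<in> T then x i else y i)"
                by (simp add: f'_def)
            qed simp
          qed
          show "\<exists>(T :: nat set) (P :: nat set set).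
             T \<subseteq> {..<n} \<and> card T \<le> m * L \<and> partition_on T P \<and> card P \<le> m \<and>
             ((L1_close {..<n} (p/2) \<epsilon> f (\<lambda>_. 0) \<and> L1_close {..<n} p \<epsilon> g (\<lambda>_. 0)) \<or>
              (L1_close {..<n} p \<epsilon> g (and_or P) \<and>
               L1_close T (p/2) \<epsilon> (restrict_avg {..<n} (p/2) T f)
                 (\<lambda>x. 2 ^ card P * lam * and_xor P x)))"
            using TP unfolding f1 g1 r1 by blast
        qed
      qed
    qed
  qed
qed

end
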